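(* Let $n = T_k + r$ with integers $k \geq 2$ and $0 \leq r \leq k$, where $T_j = j(j+1)/2$. Then \[ D(n) = \begin{cases} 3 T_{k-1} - k r & \text{if } r < \frac{k}{2},\\ 3 T_{k-1} - k (r - 1) & \text{if } r = \frac{k}{2},\\ T_{k-1} + (k + 2)(r - 1) & \text{if } r > \frac{k}{2}. \end{cases} \]
   Context: $\mathbb N=\{0,1,2,\dots\}$, $\mathbb N^*=\{1,2,\dots\}$, $T_j=j(j+1)/2$. A mancala configuration is a map $\lambda:\mathbb N^*\to\mathbb N$ whose support $\{i:\lambda_i>0\}$ equals $\{1,\dots,\ell\}$ for some $\ell=\ell(\lambda)\in\mathbb N$ (the length). Its mass is $|\lambda|=\sum_i\lambda_i$, and $\Lambda_n$ is the set of mancala configurations of mass $n$. The mancala move (sowing) $\Phi$ sends $\lambda$ to $\mu=\Phi(\lambda)$ with $\mu_i=\lambda_{i+1}+1$ for $1\le i\le\lambda_1$ and $\mu_i=\lambda_{i+1}$ for $i>\lambda_1$ (and $\Phi(0)=0$); $\Phi^t$ is its $t$-fold iterate. Configurations are ordered componentwise ($\lambda\le\mu$ iff $\lambda_i\le\mu_i$ for all $i$; $\lambda<\mu$ iff $\lambda\le\mu$ and $\lambda\ne\mu$). The marching group of order $k$ is $M^k$ with $M^k_i=k-i+1$ for $i\le k$ and $M^k_i=0$ for $i>k$. An augmented marching group is a mancala configuration $\lambda$ with $M^k\le\lambda<M^{k+1}$ for some $k\in\mathbb N$. Every mancala configuration becomes an augmented marching group after finitely many moves; the depth of $\lambda$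 is the least $t\ge0$ such that $\Phi^t(\lambda)$ is an augmented marching group, and $D(n)$ is the maximum of the depths of all $\lambda\in\Lambda_n$. *)

theory Defs
  imports Main
begin

(* Maps on the positive integers are encoded as functions on nat that vanish at the
   unused index 0.  With this convention the order of the type nat => nat is the
   componentwise order on configurations.  The support condition below forces the
   value at 0 to be 0; l = 0 gives the zero configuration. *)

definition mancala :: "(nat \<Rightarrow> nat) \<Rightarrow> bool" where
  "mancala c \<longleftrightarrow> (\<exists>l. {i. c i > 0} = {1..l})"

definition mass :: "(nat \<Rightarrow> nat) \<Rightarrow> nat" where
  "mass c = (\<Sum>i | c i > 0. c i)"

definition configs :: "nat \<Rightarrow> (nat \<Rightarrow> nat) set" where
  "configs n = {c. mancala c \<and> mass c = n}"

definition sow :: "(nat \<Rightarrow> nat) \<Rightarrow> nat \<Rightarrow> nat" where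
  "sow c i = (if i = 0 then 0
              else if i \<le> c 1 then c (i + 1) + 1
              else c (i + 1))"

definition marching_group :: "nat \<Rightarrow> nat \<Rightarrow> nat" where
  "marching_group k i = (if 1 \<le> i \<and> i \<le> k then k - i + 1 else 0)"

definition augmented_marching_group :: "(nat \<Rightarrow> nat) \<Rightarrow> bool" where
  "augmented_marching_group c \<longleftrightarrow>
     mancala c \<and> (\<exists>k. marching_group k \<le> c \<and> c < marching_group (k + 1))"

(* The set of such t is nonempty for every mancala configuration. *)
definition depth :: "(nat \<Rightarrow> nat) \<Rightarrow> nat" where
  "depth c = (LEAST t. augmented_marching_group ((sow ^^ t) c))"

(* configs n is finite and nonempty for every n. *)
definition max_depth :: "nat \<Rightarrow> nat" where
  "max_depth n = Max (depth ` configs n)"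

definition triangular :: "nat \<Rightarrow> nat" where
  "triangular j = j * (j + 1) div 2"

end

(* The q-th sown pile A(q) covers the positions q + 1, ..., q + A(q), so A(p) = c(p) + (number of
   earlier piles that cover p). The depth is governed by the last pile smaller than k and by the last
   pile larger than k + 1.

   Small piles: going back from a pile p with A(p) < d <= k to the latest pile w that fails to cover p
   yields a chain of small piles whose gaps increase. As long as the initial configuration is present,
   the gaps increase strictly, which accounts for the triangular number. Whenever a gap d is repeated,
   no pile reaches across both ends, so all seeds lie in the d - 1 positions between them, and the
   surplus over the staircase profile spreads: after b repetitions it is at most 1 in the first b
   positions and at most 2 in the first 2 * b. Counting seeds bounds b.

   Large piles: going back from a pile p with A(p) >= k + 2 to the earliest pile that covers it yields a
   chain that leaves a run of piles of size at least k + 1 behind. The run grows by at least one with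
   each step, and its length is bounded by the number r of surplus seeds. While small piles survive,
   every repeated gap of the first chain contains a member of the second, so the run is long enough at
   the time when the last small pile has disappeared.

   Both bounds are attained by configurations that begin with a long sequence of ones. *)

theory Submission
  imports Defs
begin

section \<open>Triangular numbers and masses\<close>

lemma triangular_0 [simp]: "triangular 0 = 0"
  by (simp add: triangular_def)

lemma triangular_Suc [simp]: "triangular (Suc j) = triangular j + Suc j"
proof -
  have "Suc j * (Suc j + 1) = j * (j + 1) + Suc j * 2"
    by simp
  then show ?thesis
    unfolding triangular_def by (metis div_mult_self1 zero_neq_numeral add.commute)
qed

lemma triangular_pred: "0 < d \<Longrightarrow> triangular d = triangular (d - 1) + d"
  by (cases d) auto

lemma triangular_mono: "i \<le> j \<Longrightarrow> triangular i \<le> triangular j"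
  by (induction j) (auto simp: le_Suc_eq)

lemma le_triangular: "d \<le> triangular d"
  by (induction d) auto

lemma sum_diff_triangular: "(\<Sum>s=1..<d. d - s) = triangular (d - 1)"
proof (induction d)
  case (Suc d)
  have "(\<Sum>s=1..<Suc d. Suc d - s) = (\<Sum>s=1..<Suc d. (d - s) + 1)"
    by (rule sum.cong) auto
  also have "\<dots> = (\<Sum>s=1..<Suc d. d - s) + d"
    by (subst sum.distrib) simp
  also have "(\<Sum>s=1..<Suc d. d - s) = (\<Sum>s=1..<d. d - s)"
    by (cases d) auto
  finally show ?case
    using Suc by (cases d) auto
qed simp

lemma mancalaI: "{i. 0 < f i} = {1..l} \<Longrightarrow> mancala f"
  by (auto simp: mancala_def)

lemma mass_eq_sum:
  assumes "mancala f" "finite S" "{i. 0 < f i} \<subseteq> S"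
  shows "mass f = (\<Sum>i\<in>S. f i)"
  unfolding mass_def by (rule sum.mono_neutral_left) (use assms in auto)

lemma mancala_support:
  assumes "mancala f"
  obtains l where "\<And>i. 0 < f i \<longleftrightarrow> 1 \<le> i \<and> i \<le> l"
proof -
  obtain l where l: "{i. 0 < f i} = {1..l}"
    using assms unfolding mancala_def by blast
  have "0 < f i \<longleftrightarrow> 1 \<le> i \<and> i \<le> l" for i
  proof -
    have "i \<in> {i. 0 < f i} \<longleftrightarrow> i \<in> {1..l}"
      by (simp only: l)
    then show ?thesis
      by simp
  qed
  then show thesis
    by (rule that)
qed

lemma mancala_sow:
  assumes "mancala f"
  shows "mancala (sow f)" and "mass (sow f) = mass f"
proof -
  obtain l where pos: "\<And>i. 0 < f i \<longleftrightarrow> 1 \<le> i \<and> i \<le> l"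
    by (rule mancala_support[OF assms]) (rule that)
  have sp: "{i. 0 < sow f i} = {1..max (f 1) (l - 1)}"
  proof (intro set_eqI)
    fix i
    show "i \<in> {i. 0 < sow f i} \<longleftrightarrow> i \<in> {1..max (f 1) (l - 1)}"
    proof (cases "i = 0")
      case False
      then have "0 < sow f i \<longleftrightarrow> i \<le> f 1 \<or> i + 1 \<le> l"
        using pos[of "i + 1"] by (simp add: sow_def)
      then show ?thesis
        using False by (simp only: mem_Collect_eq atLeastAtMost_iff le_max_iff_disj) linarith
    qed (simp add: sow_def)
  qed
  then show "mancala (sow f)"
    by (rule mancalaI)
  obtain L where L: "l \<le> L" "l - Suc 0 \<le> L" "f 1 \<le> L"
    using that[of "l + f 1"] by simp
  have "mass (sow f) = (\<Sum>i=1..L. sow f i)"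
    by (rule mass_eq_sum) (use L \<open>mancala (sow f)\<close> in \<open>simp_all add: sp\<close>)
  also have "\<dots> = (\<Sum>i=1..L. f (Suc i) + (if i \<le> f 1 then 1 else 0))"
    by (rule sum.cong) (auto simp: sow_def)
  also have "\<dots> = (\<Sum>i=1..L. f (Suc i)) + f 1"
  proof -
    have "(\<Sum>i=1..L. if i \<le> f 1 then 1 else 0 :: nat) = (\<Sum>i\<in>{1..f 1}. 1)"
      by (rule sum.mono_neutral_cong_right) (use L in auto)
    then show ?thesis
      by (simp add: sum.distrib)
  qed
  also have "\<dots> = (\<Sum>i=1..Suc L. f i)"
  proof -
    have "(\<Sum>i=1..Suc L. f i) = f 1 + (\<Sum>i=Suc 1..Suc L. f i)"
      by (rule sum.atLeast_Suc_atMost) simp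
    also have "(\<Sum>i=Suc 1..Suc L. f i) = (\<Sum>i=1..L. f (Suc i))"
      by (rule sum.shift_bounds_cl_Suc_ivl)
    finally show ?thesis
      by simp
  qed
  also have "\<dots> = mass f"
    by (rule mass_eq_sum[OF assms, symmetric]) (use L in \<open>auto simp: pos\<close>)
  finally show "mass (sow f) = mass f" .
qed

lemma mancala_funpow_sow:
  assumes "mancala f"
  shows "mancala ((sow ^^ t) f)" and "mass ((sow ^^ t) f) = mass f"
  using assms by (induction t) (auto simp: mancala_sow)

lemma finite_support: "mancala f \<Longrightarrow> finite {i. 0 < f i}"
  by (auto simp: mancala_def)

lemma sum_le_mass: "mancala f \<Longrightarrow> finite S \<Longrightarrow> (\<Sum>i\<in>S. f i) \<le> mass f"
proof -
  assume f: "mancala f" and S: "finite S"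
  have "(\<Sum>i\<in>S. f i) = (\<Sum>i\<in>S \<inter> {i. 0 < f i}. f i)"
    by (rule sum.mono_neutral_right) (use S in auto)
  also have "\<dots> \<le> mass f"
    unfolding mass_def by (rule sum_mono2) (auto simp: finite_support f)
  finally show ?thesis .
qed

section \<open>The sequence of sown piles\<close>

text \<open>Index \<open>i\<close> of the configuration after \<open>t\<close> moves is position \<open>t + i\<close>, so pile \<open>q\<close>, sown by
  move \<open>q\<close>, reaches exactly the positions \<open>q + 1, \<dots>, q + pile q\<close>.\<close>

locale sowing =
  fixes c :: "nat \<Rightarrow> nat"
  assumes mancala: "mancala c"
begin

definition pile :: "nat \<Rightarrow> nat" where
  "pile p = (sow ^^ (p - 1)) c 1"

definition covers :: "nat \<Rightarrow> nat set" where
  "covers p = {q. 0 < q \<and> q < p \<and> p \<le> q + pile q}"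

lemma c_0: "c 0 = 0"
proof -
  obtain l where "\<And>i. 0 < c i \<longleftrightarrow> 1 \<le> i \<and> i \<le> l"
    by (rule mancala_support[OF mancala]) (rule that)
  from this[of 0] show ?thesis
    by simp
qed

lemma c_pos_mono: "0 < c p \<Longrightarrow> 0 < q \<Longrightarrow> q \<le> p \<Longrightarrow> 0 < c q"
proof -
  assume a: "0 < c p" "0 < q" "q \<le> p"
  obtain l where l: "\<And>i. 0 < c i \<longleftrightarrow> 1 \<le> i \<and> i \<le> l"
    by (rule mancala_support[OF mancala]) (rule that)
  show ?thesis
    using a l[of p] l[of q] by linarith
qed

lemma c_zero_mono: "c p = 0 \<Longrightarrow> 0 < p \<Longrightarrow> p \<le> q \<Longrightarrow> c q = 0"
  using c_pos_mono[of q p] by (cases "c q = 0") simp_all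

lemma finite_covers [simp]: "finite (covers p)"
  by (rule finite_subset[of _ "{..p}"]) (auto simp: covers_def)

text \<open>On the absolute axis a move shifts only the origin; position \<open>t + i\<close> stays
  fixed and gains a seed exactly when the pile being sown reaches it.\<close>

lemma config_eq:
  "0 < i \<Longrightarrow> (sow ^^ t) c i = c (t + i) + card {q. 0 < q \<and> q \<le> t \<and> t + i \<le> q + pile q}"
proof (induction t arbitrary: i)
  case 0
  have "{q. 0 < q \<and> q \<le> 0 \<and> 0 + i \<le> q + pile q} = {}"
    by auto
  then show ?case
    by (metis add_0 add_0_right card.empty funpow_0)
next
  case (Suc t)
  let ?S = "{q. 0 < q \<and> q \<le> t \<and> Suc t + i \<le> q + pile q}"
  have "finite ?S"
    by (rule finite_subset[of _ "{..t}"]) auto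
  have eq: "{q. 0 < q \<and> q \<le> Suc t \<and> Suc t + i \<le> q + pile q}
    = (if i \<le> pile (Suc t) then insert (Suc t) ?S else ?S)"
    by (auto simp: le_Suc_eq)
  have p: "pile (Suc t) = (sow ^^ t) c 1"
    by (simp add: pile_def)
  have "(sow ^^ Suc t) c i = (sow ^^ t) c (i + 1) + (if i \<le> pile (Suc t) then 1 else 0)"
    using Suc.prems by (simp add: sow_def p)
  also have "(sow ^^ t) c (i + 1) = c (Suc t + i) + card ?S"
    using Suc.IH[of "i + 1"] by simp
  finally show ?case
    unfolding eq using \<open>finite ?S\<close> by simp
qed

lemma pile_eq: "0 < p \<Longrightarrow> pile p = c p + card (covers p)"
proof -
  assume p: "0 < p"
  have "{q. 0 < q \<and> q \<le> p - 1 \<and> p - 1 + 1 \<le> q + pile q} = covers p"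
    using p by (auto simp: covers_def)
  then show ?thesis
    using config_eq[of 1 "p - 1"] p by (simp add: pile_def)
qed

lemma pile_ge: "0 < p \<Longrightarrow> S \<subseteq> covers p \<Longrightarrow> c p + card S \<le> pile p"
  by (simp add: pile_eq card_mono)

text \<open>The covers of \<open>t + i\<close> are split at time \<open>t\<close>: the earlier ones
  together with the initial seeds make up entry \<open>i\<close> at that time.\<close>

lemma pile_split:
  assumes "0 < i"
  shows "pile (t + i) = (sow ^^ t) c i + card {q \<in> covers (t + i). t < q}"
proof -
  let ?P = "{q. 0 < q \<and> q \<le> t \<and> t + i \<le> q + pile q}"
  let ?Q = "{q \<in> covers (t + i). t < q}"
  have eq: "?P \<union> ?Q = covers (t + i)"
    using assms by (auto simp: covers_def)
  have "finite ?P"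
    by (rule finite_subset[of _ "{..t}"]) auto
  then have "card (?P \<union> ?Q) = card ?P + card ?Q"
    by (intro card_Un_disjoint) auto
  then show ?thesis
    unfolding eq using assms pile_eq[of "t + i"] config_eq[of i t] by linarith
qed

lemma card_covers_le: "0 < p \<Longrightarrow> S \<subseteq> covers p \<Longrightarrow> card S \<le> pile p"
  using pile_ge[of p S] by simp

lemma sum_config_le: "finite S \<Longrightarrow> (\<Sum>i\<in>S. (sow ^^ t) c i) \<le> mass c"
  using sum_le_mass[OF mancala_funpow_sow(1)[OF mancala], of S t]
  unfolding mancala_funpow_sow(2)[OF mancala] .

lemma mass_eq_sum_config:
  assumes "(sow ^^ t) c d = 0" "0 < d"
  shows "mass c = (\<Sum>s=1..<d. (sow ^^ t) c s)"
proof -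
  let ?f = "(sow ^^ t) c"
  have f: "mancala ?f"
    by (rule mancala_funpow_sow[OF mancala])
  obtain l where l: "\<And>i. 0 < ?f i \<longleftrightarrow> 1 \<le> i \<and> i \<le> l"
    by (rule mancala_support[OF f]) (rule that)
  have "l < d"
    using l[of d] assms by linarith
  then have "{i. 0 < ?f i} \<subseteq> {1..<d}"
    unfolding l by auto
  then have "mass ?f = (\<Sum>s=1..<d. ?f s)"
    by (rule mass_eq_sum[OF f finite_atLeastLessThan])
  then show ?thesis
    by (simp only: mancala_funpow_sow[OF mancala])
qed

lemma latest_noncover:
  "covers p = {0<..<p} \<or>
    (\<exists>w. 0 < w \<and> w < p \<and> w + pile w < p \<and> {w<..<p} \<subseteq> covers p)"
proof (cases "covers p = {0<..<p}")
  case False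
  let ?N = "{0<..<p} - covers p"
  have "covers p \<subseteq> {0<..<p}"
    by (auto simp: covers_def)
  then have "?N \<noteq> {}"
    using False by blast
  then have M: "Max ?N \<in> ?N"
    by (intro Max_in) auto
  have "q \<in> covers p" if "Max ?N < q" "q < p" for q
  proof (rule ccontr)
    assume "q \<notin> covers p"
    then have "q \<in> ?N"
      using that by auto
    then have "q \<le> Max ?N"
      by (intro Max_ge) auto
    then show False
      using that by simp
  qed
  then have "{Max ?N<..<p} \<subseteq> covers p"
    by auto
  moreover have "0 < Max ?N" "Max ?N < p" "Max ?N + pile (Max ?N) < p"
    using M by (auto simp: covers_def)
  ultimately show ?thesis
    by blast
qed simp

text \<open>Let \<open>w\<close> be the latest pile that fails to cover \<open>p\<close>. The piles
  in between and the initial seed at \<open>p\<close> make \<open>pile p\<close> at least the gap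
  \<open>p - w\<close>, which exceeds \<open>pile w\<close>. So the gaps shrink strictly on the way
  back and add up to at most \<open>triangular (d - 1)\<close>.\<close>

lemma ones_bound: "0 < c p \<Longrightarrow> pile p < d \<Longrightarrow> p \<le> triangular (d - 1)"
proof (induction p arbitrary: d rule: less_induct)
  case (less p)
  have p: "0 < p"
    using less.prems c_0 by (cases p) auto
  consider (none) "covers p = {0<..<p}"
    | (some) w where "0 < w" "w < p" "w + pile w < p" "{w<..<p} \<subseteq> covers p"
    using latest_noncover by blast
  then show ?case
  proof cases
    case none
    then have "p \<le> d - 1"
      using less.prems pile_eq[OF p] by simp
    then show ?thesis
      using le_triangular[of "d - 1"] by simp
  next
    case (some w)
    define e where "e = p - w"
    have "0 < c w"
      using less.prems c_pos_mono some by simp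
    moreover have "pile w < e"
      using some by (simp add: e_def)
    ultimately have w: "w \<le> triangular (e - 1)"
      using less.IH some by blast
    have "c p + (e - 1) \<le> pile p"
      using pile_ge[OF p some(4)] by (simp add: e_def)
    then have "e \<le> d - 1"
      using less.prems by simp
    have "p = w + e" "0 < e"
      using some by (auto simp: e_def)
    then have "p \<le> triangular e"
      using w by (simp add: triangular_pred)
    also have "\<dots> \<le> triangular (d - 1)"
      by (rule triangular_mono) fact
    finally show ?thesis .
  qed
qed

end

section \<open>Small piles\<close>

context sowing
begin

text \<open>Ancestry under the earliest-cover relation: \<open>l\<close> counts the steps back until
  a pile with initial seeds is met.\<close>

inductive chain :: "nat \<Rightarrow> nat \<Rightarrow> nat \<Rightarrow> bool" for K where
  chain_start: "0 < c q \<Longrightarrow> K \<le> pile q \<Longrightarrow> chain K 0 q"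
| chain_step: "chain K l w \<Longrightarrow> w \<in> covers q \<Longrightarrow> \<forall>x \<in> covers q. w \<le> x \<Longrightarrow> c q = 0
    \<Longrightarrow> K \<le> pile q \<Longrightarrow> chain K (Suc l) q"

lemma chain_pile: "chain K l q \<Longrightarrow> K \<le> pile q"
  by (erule chain.cases) auto

lemma chain_pos: "chain K l q \<Longrightarrow> 0 < q"
proof (induction rule: chain.induct)
  case (chain_start q)
  then show ?case
    using c_0 by (cases q) simp_all
qed (simp add: covers_def)

text \<open>If \<open>marching_group (d - 1)\<close> sat right behind \<open>p\<close>, every
  \<open>pile (p + s)\<close> would be \<open>d - 1\<close>. The surplus over this is at most 1 for
  \<open>s \<le> a\<close> and at most 2 for \<open>s \<le> b\<close>.\<close>

definition profile :: "nat \<Rightarrow> nat \<Rightarrow> nat \<Rightarrow> nat \<Rightarrow> bool" where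
  "profile p d a b \<longleftrightarrow> (\<forall>s. 0 < s \<and> s < d \<longrightarrow>
     (s \<le> a \<longrightarrow> pile (p + s) \<le> d) \<and> (s \<le> b \<longrightarrow> pile (p + s) \<le> d + 1))"

text \<open>A pile covering \<open>p + s\<close> already covers \<open>p\<close> or is one of the
  \<open>s\<close> piles from \<open>p\<close> on, so the bound on \<open>pile p\<close> worsens by
  at most one per position.\<close>

lemma profile_start:
  assumes "0 < p" "pile p < d" "\<And>q. p < q \<Longrightarrow> c q = 0"
  shows "profile p d 1 2"
proof -
  have "pile (p + s) < d + s" if "0 < s" for s
  proof -
    have "covers (p + s) \<subseteq> covers p \<union> {p..<p + s}"
      by (auto simp: covers_def)
    then have "card (covers (p + s)) \<le> card (covers p \<union> {p..<p + s})"
      by (intro card_mono) auto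
    also have "\<dots> \<le> card (covers p) + s"
      using card_Un_le[of "covers p" "{p..<p + s}"] by simp
    finally show ?thesis
      using assms(1,2) assms(3)[of "p + s"] that pile_eq[of p] pile_eq[of "p + s"] by simp
  qed
  note b = this
  show ?thesis
    unfolding profile_def
  proof (intro allI impI conjI; elim conjE)
    fix s
    show "0 < s \<Longrightarrow> s \<le> 1 \<Longrightarrow> pile (p + s) \<le> d" "0 < s \<Longrightarrow> s \<le> 2 \<Longrightarrow> pile (p + s) \<le> d + 1"
      using b[of s] by simp_all
  qed
qed

text \<open>Compared with \<open>p\<close>, position \<open>p + s\<close> gains at most the
  \<open>s\<close> piles from \<open>p\<close> on but loses the piles \<open>w + u\<close> that stop
  short of it. With surplus at most 1 these stop short for \<open>u < s\<close>, with surplus at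
  most 2 for \<open>u < s - 1\<close>; hence the two ranges grow by one and by two.\<close>

lemma profile_step:
  assumes w: "0 < w" "w < p" "w + pile w < p" "{w<..<p} \<subseteq> covers p"
    and p: "pile p < d" "\<And>q. p \<le> q \<Longrightarrow> c q = 0"
    and prof: "profile w (p - w) a b"
    and s: "0 < s"
  shows "s \<le> a + 1 \<Longrightarrow> s \<le> p - w \<Longrightarrow> pile (p + s) \<le> d"
    and "s \<le> b + 2 \<Longrightarrow> s \<le> p - w + 1 \<Longrightarrow> pile (p + s) \<le> d + 1"
proof -
  define e where "e = p - w"
  have pe: "p = w + e" "0 < e"
    using w by (simp_all add: e_def)
  let ?F = "covers p - {w<..<p}"
  have "card (covers p) = card ?F + card {w<..<p}"
    using w(4) card_mono[OF finite_covers w(4)] card_Diff_subset[OF _ w(4)] by simp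
  \<comment> \<open>\<open>?F\<close> consists of the covers of \<open>p\<close> older than
    \<open>w\<close>; the \<open>e - 1\<close> piles in between take up the rest of at most
    \<open>d - 1\<close> covers.\<close>
  moreover have "card (covers p) < d"
    using p pile_eq[of p] w by simp
  ultimately have F: "card ?F + e \<le> d"
    by (simp add: pe)
  \<comment> \<open>The \<open>m - 1\<close> piles \<open>w + u\<close> with \<open>u < m\<close>
    end before \<open>p + s\<close>. The two claims take \<open>m = s\<close> and
    \<open>m = s - 1\<close>, with \<open>m = 1\<close> for \<open>s = 1\<close>.\<close>
  have main: "pile (p + s) + m \<le> d + s"
    if m: "\<And>u. 0 < u \<Longrightarrow> u < e \<Longrightarrow> u < m \<Longrightarrow> u + pile (w + u) < e + s" "m \<le> e" "0 < m" for m
  proof -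
    let ?G = "{w + m..<p}"
    have "covers (p + s) \<subseteq> ?F \<union> ?G \<union> {p..<p + s}"
    proof
      fix q
      assume q: "q \<in> covers (p + s)"
      show "q \<in> ?F \<union> ?G \<union> {p..<p + s}"
      proof (cases "w < q \<and> q < p")
        case True
        then obtain u where u: "q = w + u" "0 < u" "u < e"
          using less_imp_add_positive[of w q] pe by auto
        have "\<not> u + pile (w + u) < e + s"
          using q by (simp add: covers_def pe u)
        then have "m \<le> u"
          using m(1) u by (meson not_less)
        then show ?thesis
          using True u by simp
      next
        case False
        then show ?thesis
          using q by (auto simp: covers_def)
      qed
    qed
    then have "card (covers (p + s)) \<le> card (?F \<union> ?G \<union> {p..<p + s})"
      by (intro card_mono) auto
    also have "\<dots> \<le> card ?F + card ?G + card {p..<p + s}"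
      using card_Un_le[of "?F \<union> ?G" "{p..<p + s}"] card_Un_le[of ?F ?G] by linarith
    also have "\<dots> = card ?F + (e - m) + s"
      by (simp add: pe)
    finally show ?thesis
      using F m(2) p(2)[of "p + s"] pile_eq[of "p + s"] w by simp
  qed
  have prof: "s \<le> a \<Longrightarrow> pile (w + s) \<le> e" "s \<le> b \<Longrightarrow> pile (w + s) \<le> e + 1"
    if "0 < s" "s < e" for s
    using prof that unfolding profile_def e_def by auto
  show "pile (p + s) \<le> d" if "s \<le> a + 1" "s \<le> p - w"
  proof -
    have "pile (p + s) + s \<le> d + s"
    proof (rule main)
      show "u + pile (w + u) < e + s" if "0 < u" "u < e" "u < s" for u
        using prof(1)[of u] that \<open>s \<le> a + 1\<close> by simp
    qed (use that s in \<open>simp_all add: e_def\<close>)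
    then show ?thesis
      by simp
  qed
  show "pile (p + s) \<le> d + 1" if "s \<le> b + 2" "s \<le> p - w + 1"
  proof (cases "s = 1")
    case True
    have "pile (p + s) + 1 \<le> d + s"
      by (rule main) (use pe in auto)
    then show ?thesis
      using True by simp
  next
    case False
    have "pile (p + s) + (s - 1) \<le> d + s"
    proof (rule main)
      show "u + pile (w + u) < e + s" if "0 < u" "u < e" "u < s - 1" for u
      proof -
        have "u \<le> b"
          using that \<open>s \<le> b + 2\<close> by linarith
        then have "pile (w + u) \<le> e + 1"
          using prof(2) that by blast
        then show ?thesis
          using that by linarith
      qed
    qed (use that s False in \<open>simp_all add: e_def\<close>)
    then show ?thesis
      using False s by simp
  qed
qed

text \<open>If the small pile \<open>p\<close> is as little covered as the distance \<open>p - w\<close> permits, then no pile reaches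
  across both \<open>w\<close> and \<open>p\<close>, so after \<open>w\<close> moves all seeds lie strictly between them.\<close>

lemma mass_between_holes:
  assumes w: "0 < w" "w < p" "{w<..<p} \<subseteq> covers p"
    and p: "pile p < p - w" "\<And>q. w < q \<Longrightarrow> c q = 0"
  shows "mass c + (\<Sum>s=1..<p - w. s - 1) = (\<Sum>s=1..<p - w. pile (w + s))"
    and "\<And>q. q \<in> covers p \<Longrightarrow> w < q"
proof -
  define d where "d = p - w"
  have pd: "p = w + d" "0 < d"
    using w by (simp_all add: d_def)
  have "card {w<..<p} = d - 1"
    by (simp add: pd)
  moreover have "card (covers p) < d"
    using p pile_eq[of p] w pd by simp
  ultimately have eq: "covers p = {w<..<p}"
    using card_seteq[of "covers p" "{w<..<p}"] w by simp
  then show "\<And>q. q \<in> covers p \<Longrightarrow> w < q"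
    by simp
  have "{q \<in> covers (w + d). w < q} = {w<..<p}"
    unfolding pd(1)[symmetric] eq by auto
  then have "pile p = (sow ^^ w) c d + (d - 1)"
    using pile_split[of d w] pd by simp
  moreover have "pile p < d"
    using p by (simp add: d_def)
  \<comment> \<open>The \<open>d - 1\<close> piles sown after \<open>w\<close> exhaust
    \<open>pile p\<close>, so entry \<open>d\<close> at time \<open>w\<close> is empty, and with it
    everything beyond.\<close>
  ultimately have "(sow ^^ w) c d = 0"
    by simp
  then have "mass c = (\<Sum>s=1..<d. (sow ^^ w) c s)"
    by (rule mass_eq_sum_config) (rule pd)
  moreover
  \<comment> \<open>Each pile strictly between \<open>w\<close> and \<open>w + s\<close> covers
    \<open>p\<close>, hence also \<open>w + s\<close>, and contributes one seed.\<close>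
  have "(sow ^^ w) c s + (s - 1) = pile (w + s)" if "s \<in> {1..<d}" for s
  proof -
    have "{q \<in> covers (w + s). w < q} = {w<..<w + s}"
    proof
      show "{w<..<w + s} \<subseteq> {q \<in> covers (w + s). w < q}"
      proof
        fix q
        assume q: "q \<in> {w<..<w + s}"
        then have "q \<in> covers p"
          using eq that pd by simp
        then show "q \<in> {q \<in> covers (w + s). w < q}"
          using q that by (auto simp: covers_def pd)
      qed
    qed (auto simp: covers_def)
    then show ?thesis
      using pile_split[of s w] that by simp
  qed
  then have "(\<Sum>s=1..<d. (sow ^^ w) c s + (s - 1)) = (\<Sum>s=1..<d. pile (w + s))"
    by (intro sum.cong refl)
  ultimately show "mass c + (\<Sum>s=1..<p - w. s - 1) = (\<Sum>s=1..<p - w. pile (w + s))"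
    unfolding d_def[symmetric] sum.distrib by linarith
qed

text \<open>With \<open>y = 0\<close> the seeds would fit under
  \<open>marching_group (p - w - 1)\<close>; \<open>y\<close> measures the surplus over that
  staircase.\<close>

lemma mass_between_holes_le:
  assumes w: "0 < w" "w < p" "{w<..<p} \<subseteq> covers p"
    and p: "pile p < p - w" "\<And>q. w < q \<Longrightarrow> c q = 0"
    and y: "\<And>s. 0 < s \<Longrightarrow> s < p - w \<Longrightarrow> pile (w + s) + 1 \<le> p - w + y s"
  shows "mass c \<le> triangular (p - w - 1) + (\<Sum>s=1..<p - w. y s)"
proof -
  define d where "d = p - w"
  have "mass c + (\<Sum>s=1..<d. s - 1) = (\<Sum>s=1..<d. pile (w + s))"
    using mass_between_holes(1)[OF w p] by (simp add: d_def)
  also have "\<dots> \<le> (\<Sum>s=1..<d. (d - s) + (s - 1) + y s)"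
  proof (rule sum_mono)
    fix s
    assume "s \<in> {1..<d}"
    then show "pile (w + s) \<le> (d - s) + (s - 1) + y s"
      using y[of s] by (simp add: d_def)
  qed
  also have "\<dots> = triangular (d - 1) + (\<Sum>s=1..<d. s - 1) + (\<Sum>s=1..<d. y s)"
    by (simp only: sum.distrib sum_diff_triangular)
  finally show ?thesis
    by (simp add: d_def)
qed

end

lemma sum_one_two: "(\<Sum>s=1..<Suc m. if s \<le> x then 1 else 2) + min x m = 2 * m"
  by (induction m) auto

context sowing
begin

text \<open>Strict drops of the gap pay for the triangular number, as in \<open>ones_bound\<close>.
  \<open>\<beta>\<close> starts at 1 and grows by one whenever a gap is repeated; the profile widens
  with it, and counting seeds bounds it. The last clause serves the large piles: each repetition
  forces one more generation in any chain that reaches beyond \<open>p\<close>.\<close>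

lemma hole_invariant:
  assumes mass: "triangular k + r \<le> mass c" and r: "2 * r < k" "2 \<le> k"
  shows "0 < p \<Longrightarrow> pile p < d \<Longrightarrow> d \<le> k \<Longrightarrow>
    (0 < c p \<and> p \<le> triangular (d - 1)) \<or>
    ((\<forall>q>p. c q = 0) \<and> (\<exists>\<beta>\<ge>1. p \<le> triangular (d - 1) + d * \<beta> \<and> profile p d \<beta> (2 * \<beta>) \<and>
      (d < k \<longrightarrow> 2 * \<beta> \<le> d + 1) \<and> (d = k \<longrightarrow> \<beta> + r + 1 \<le> k) \<and>
      (\<forall>l q. chain (k + 2) l q \<longrightarrow> p < q + pile q \<longrightarrow> \<beta> \<le> l + 1)))"
proof (induction p arbitrary: d rule: less_induct)
  case (less p)
  note p = less.prems
  \<comment> \<open>Base of the count: \<open>triangular d\<close> equals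
    \<open>triangular (d - 1) + d * 1\<close>, the bound for \<open>\<beta> = 1\<close>.\<close>
  have first: ?case if "c p = 0" "p \<le> triangular d"
  proof -
    have z: "c q = 0" if "p < q" for q
      using c_zero_mono[OF \<open>c p = 0\<close> p(1), of q] that by simp
    have "p \<le> triangular (d - 1) + d * 1"
      using that triangular_pred[of d] p by simp
    moreover have "profile p d 1 (2 * 1)"
      using profile_start[OF p(1,2) z] by simp
    moreover have "2 * 1 \<le> d + 1" "1 + r + 1 \<le> k"
      using p r by simp_all
    ultimately have "\<exists>\<beta>\<ge>1. p \<le> triangular (d - 1) + d * \<beta> \<and> profile p d \<beta> (2 * \<beta>) \<and>
      (d < k \<longrightarrow> 2 * \<beta> \<le> d + 1) \<and> (d = k \<longrightarrow> \<beta> + r + 1 \<le> k) \<and>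
      (\<forall>l q. chain (k + 2) l q \<longrightarrow> p < q + pile q \<longrightarrow> \<beta> \<le> l + 1)"
      by (intro exI[of _ 1]) simp
    then show ?thesis
      using z by blast
  qed
  consider (pos) "0 < c p" | (none) "c p = 0" "covers p = {0<..<p}"
    | (some) w where "c p = 0" "0 < w" "w < p" "w + pile w < p" "{w<..<p} \<subseteq> covers p"
    using latest_noncover by blast
  then show ?case
  proof cases
    case pos
    then show ?thesis
      using ones_bound p by blast
  next
    case none
    then have "p \<le> d"
      using pile_eq[OF p(1)] p by simp
    then show ?thesis
      using first none le_triangular[of d] by simp
  next
    case (some w)
    define e where "e = p - w"
    have pe: "p = w + e" "0 < e"
      using some by (simp_all add: e_def)
    have ed: "e \<le> d"
      using card_covers_le[OF p(1) some(5)] p pe by simp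
    have we: "pile w < e"
      using some by (simp add: e_def)
    have zp: "c q = 0" if "p \<le> q" for q
      using c_zero_mono[OF some(1) p(1) that] .
    have Te: "triangular e = triangular (e - 1) + e"
      using pe by (simp add: triangular_pred)
    have "e \<le> k"
      using ed p(3) by simp
    from less.IH[OF some(3) some(2) we this]
    consider (pre) "w \<le> triangular (e - 1)"
      | (post) \<beta> where "\<forall>q>w. c q = 0" "1 \<le> \<beta>" "w \<le> triangular (e - 1) + e * \<beta>"
          "profile w e \<beta> (2 * \<beta>)" "e < k \<longrightarrow> 2 * \<beta> \<le> e + 1" "e = k \<longrightarrow> \<beta> + r + 1 \<le> k"
          "\<forall>l q. chain (k + 2) l q \<longrightarrow> w < q + pile q \<longrightarrow> \<beta> \<le> l + 1"
      by blast
    then show ?thesis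
    proof cases
      case pre
      then have "p \<le> triangular e"
        using Te pe by simp
      also have "\<dots> \<le> triangular d"
        using ed by (rule triangular_mono)
      finally show ?thesis
        using first some by simp
    next
      case post
      have prof: "profile w (p - w) \<beta> (2 * \<beta>)"
        using post by (simp add: e_def)
      note step = profile_step[OF some(2-5) p(2) zp prof, folded e_def]
      have "\<exists>\<beta>'\<ge>1. p \<le> triangular (d - 1) + d * \<beta>' \<and> profile p d \<beta>' (2 * \<beta>') \<and>
        (d < k \<longrightarrow> 2 * \<beta>' \<le> d + 1) \<and> (d = k \<longrightarrow> \<beta>' + r + 1 \<le> k) \<and>
        (\<forall>l q. chain (k + 2) l q \<longrightarrow> p < q + pile q \<longrightarrow> \<beta>' \<le> l + 1)"
      proof (cases "e < d")
        case True
        then have \<beta>: "2 * \<beta> \<le> e + 1"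
          using post p by simp
        \<comment> \<open>The gap has dropped, so \<open>triangular e\<close> fits under
          \<open>triangular (d - 1)\<close> and \<open>\<beta>\<close> is kept.\<close>
        have "p \<le> triangular e + e * \<beta>"
          using post pe Te by simp
        also have "\<dots> \<le> triangular (d - 1) + d * \<beta>"
          using True by (intro add_mono triangular_mono mult_le_mono1) simp_all
        finally have "p \<le> triangular (d - 1) + d * \<beta>" .
        moreover have "profile p d \<beta> (2 * \<beta>)"
          unfolding profile_def
        proof (intro allI impI conjI)
          fix s
          assume s: "0 < s \<and> s < d"
          show "pile (p + s) \<le> d" if "s \<le> \<beta>"
            using that s \<beta> pe by (intro step(1)) simp_all
          show "pile (p + s) \<le> d + 1" if "s \<le> 2 * \<beta>"
            using that s \<beta> pe by (intro step(2)) simp_all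
        qed
        moreover have "d < k \<longrightarrow> 2 * \<beta> \<le> d + 1" "d = k \<longrightarrow> \<beta> + r + 1 \<le> k"
          using \<beta> True r by auto
        moreover have "\<forall>l q. chain (k + 2) l q \<longrightarrow> p < q + pile q \<longrightarrow> \<beta> \<le> l + 1"
        proof (intro allI impI)
          fix l q
          assume "chain (k + 2) l q" "p < q + pile q"
          then show "\<beta> \<le> l + 1"
            using post(7)[rule_format, of l q] pe by simp
        qed
        ultimately show ?thesis
          using post(2) by blast
      next
        case False
        then have de: "d = e"
          using ed by simp
        have pd: "pile p < p - w"
          using p de by (simp add: e_def)
        have zw: "c q = 0" if "w < q" for q
          using post(1) that by blast
        note mass_le = mass_between_holes_le[OF some(2,3,5) pd zw, folded e_def]
        note across = mass_between_holes(2)[OF some(2,3,5) pd zw]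
        have y: "pile (w + s) + 1 \<le> e + (if s \<le> \<beta> then 1 else 2)"
          if "0 < s" "s < e" "e \<le> 2 * \<beta> + 1" for s
          using post(4)[unfolded profile_def, rule_format, of s] that by simp
        \<comment> \<open>Otherwise the surplus is at most 2 on all \<open>e - 1\<close> positions,
          which leaves fewer than \<open>triangular (e + 1)\<close> seeds, too few if
          \<open>e < k\<close>.\<close>
        have lt: "2 * \<beta> + 1 < e" if "e < k"
        proof (rule ccontr)
          assume "\<not> 2 * \<beta> + 1 < e"
          have "mass c \<le> triangular (e - 1) + (\<Sum>s=1..<e. 2)"
          proof (rule mass_le)
            fix s
            assume "0 < s" "s < e"
            then show "pile (w + s) + 1 \<le> e + 2"
              using y[of s] \<open>\<not> 2 * \<beta> + 1 < e\<close> by (simp split: if_splits)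
          qed
          then have "mass c < triangular (e - 1) + e + (e + 1)"
            by simp
          also have "\<dots> = triangular (Suc e)"
            using Te by simp
          also have "\<dots> \<le> triangular k"
            using that by (intro triangular_mono) simp
          finally show False
            using mass by simp
        qed
        \<comment> \<open>Otherwise the surplus is at most 1 on the first \<open>\<beta>\<close>
          positions and at most 2 on the others, which is less than the available
          \<open>triangular (k - 1) + k + r\<close> seeds require.\<close>
        have lt': "\<beta> + 1 + r + 1 \<le> k" if "e = k"
        proof (rule ccontr)
          assume neg: "\<not> \<beta> + 1 + r + 1 \<le> k"
          then have "e \<le> 2 * \<beta> + 1"
            using r that by simp
          with y have "mass c \<le> triangular (e - 1) + (\<Sum>s=1..<e. if s \<le> \<beta> then 1 else 2)"
            by (intro mass_le)
          moreover have "(\<Sum>s=1..<e. if s \<le> \<beta> then 1 else 2) + min \<beta> (e - 1) = 2 * (e - 1)"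
            using sum_one_two[where m = "e - 1" and x = \<beta>] pe by simp
          ultimately have "mass c + min \<beta> (e - 1) \<le> triangular (e - 1) + 2 * (e - 1)"
            by linarith
          moreover have "triangular (e - 1) + e + r \<le> mass c"
            using mass that Te by simp
          ultimately show False
            using neg that r by (simp add: min_def split: if_splits)
        qed
        have "p \<le> triangular (d - 1) + d * (\<beta> + 1)"
          using post pe de by simp
        moreover have "profile p d (\<beta> + 1) (2 * (\<beta> + 1))"
          unfolding profile_def
        proof (intro allI impI conjI)
          fix s
          assume s: "0 < s \<and> s < d"
          show "pile (p + s) \<le> d" if "s \<le> \<beta> + 1"
            using that s de by (intro step(1)) simp_all
          show "pile (p + s) \<le> d + 1" if "s \<le> 2 * (\<beta> + 1)"
            using that s de by (intro step(2)) simp_all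
        qed
        moreover have "d < k \<longrightarrow> 2 * (\<beta> + 1) \<le> d + 1"
          using lt de Suc_leI[of "2 * \<beta> + 1" e] by auto
        moreover have "d = k \<longrightarrow> (\<beta> + 1) + r + 1 \<le> k"
          using lt' de by simp
        moreover have "\<beta> + 1 \<le> l + 1" if ch: "chain (k + 2) l q" "p < q + pile q" for l q
        proof -
          \<comment> \<open>A large pile before \<open>w\<close> that reaches beyond
            \<open>p\<close> would cover \<open>p\<close>, which the repeated gap excludes. So
            \<open>q\<close> comes after \<open>w\<close>, its predecessor reaches beyond
            \<open>w\<close>, and the induction applies with one generation less.\<close>
          have "w < q"
          proof (rule ccontr)
            assume "\<not> w < q"
            moreover have "q \<noteq> w"
              using chain_pile[OF ch(1)] we ed p(3) by (cases "q = w") simp_all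
            moreover have "0 < q"
              by (rule chain_pos[OF ch(1)])
            ultimately have "q \<in> covers p"
              using ch(2) some by (simp add: covers_def)
            then show False
              using across \<open>\<not> w < q\<close> by blast
          qed
          from ch(1) show ?thesis
          proof (cases rule: chain.cases)
            case chain_start
            then show ?thesis
              using zw \<open>w < q\<close> by simp
          next
            case (chain_step l' w')
            have "q \<le> w' + pile w'"
              using chain_step by (simp add: covers_def)
            then have "w < w' + pile w'"
              using \<open>w < q\<close> by simp
            then have "\<beta> \<le> l' + 1"
              using post(7) chain_step(2) by blast
            then show ?thesis
              using chain_step(1) by simp
          qed
        qed
        ultimately show ?thesis
          by (intro exI[of _ "\<beta> + 1"]) simp
      qed
      then show ?thesis
        using zp by (intro disjI2 conjI) simp_all
    qed
  qed
qed

end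

section \<open>Large piles\<close>

lemma sum_indicator_reversed: "(\<Sum>v<k. v + (if v < a then 1 else 0)) + k = triangular k + min a k"
  by (induction k) auto

lemma sum_staircase: "(\<Sum>i<k + m. (k - i) + (if k \<le> i then 1 else 0)) = triangular k + m"
proof (induction m)
  case 0
  have "(\<Sum>i<k. k - i) = triangular k"
    by (induction k) (simp_all only: sum.lessThan_Suc_shift, simp_all)
  moreover have "(\<Sum>i<k. (k - i) + (if k \<le> i then 1 else 0)) = (\<Sum>i<k. k - i)"
    by (rule sum.cong) auto
  ultimately show ?case
    by simp
qed simp

context sowing
begin

lemma chain_index: "chain K l q \<Longrightarrow> l < q"
  by (induction rule: chain.induct) (auto simp: covers_def c_0 intro: Nat.gr0I)

text \<open>All covers lie between the earliest one and \<open>q\<close>, which that one reaches. So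
  sizes never decrease on the way back, and a chain stays above its threshold.\<close>

lemma earliest_cover:
  assumes "0 < q" "c q = 0" "0 < pile q"
  obtains w where "w \<in> covers q" "\<forall>x \<in> covers q. w \<le> x" "pile q \<le> q - w" "q - w \<le> pile w"
proof -
  have card: "card (covers q) = pile q"
    using pile_eq[OF assms(1)] assms(2) by simp
  then have "covers q \<noteq> {}"
    using assms(3) by (cases "covers q = {}") simp_all
  then have w: "Min (covers q) \<in> covers q" "\<forall>x \<in> covers q. Min (covers q) \<le> x"
    by simp_all
  then have "covers q \<subseteq> {Min (covers q)..<q}"
    by (auto simp: covers_def)
  then have "pile q \<le> q - Min (covers q)"
    using card_mono[of "{Min (covers q)..<q}" "covers q"] card by simp
  moreover have "q \<le> Min (covers q) + pile (Min (covers q))"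
    using w(1) unfolding covers_def[of q] by blast
  then have "q - Min (covers q) \<le> pile (Min (covers q))"
    by linarith
  ultimately show thesis
    using w that by blast
qed

lemma chain_exists: "0 < K \<Longrightarrow> 0 < q \<Longrightarrow> K \<le> pile q \<Longrightarrow> \<exists>l. chain K l q"
proof (induction q rule: less_induct)
  case (less q)
  show ?case
  proof (cases "c q = 0")
    case False
    then show ?thesis
      using chain_start[of q K] less.prems by blast
  next
    case True
    then obtain w where w: "w \<in> covers q" "\<forall>x \<in> covers q. w \<le> x" "pile q \<le> q - w" "q - w \<le> pile w"
      using earliest_cover[of q] less.prems by auto
    then have "\<exists>l. chain K l w"
      using less.IH[of w] less.prems by (simp add: covers_def)
    then show ?thesis
      using chain_step[OF _ w(1,2) True] less.prems by blast
  qed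
qed

text \<open>Let \<open>w\<close> be the earliest cover of \<open>q\<close>. Position
  \<open>q - 1 - v\<close> keeps \<open>w\<close> and loses at most \<open>v + 1\<close> covers of
  \<open>q\<close>, but gains the \<open>v\<close> piles directly before \<open>w\<close>, which by
  induction are at most one smaller than \<open>w\<close> and reach far enough.\<close>

lemma chain_run: "chain K l q \<Longrightarrow> v < l \<Longrightarrow> v + 2 \<le> K \<Longrightarrow> pile q \<le> pile (q - 1 - v) + 1"
proof (induction arbitrary: v rule: chain.induct)
  case (chain_step l w q)
  define x where "x = q - 1 - v"
  have q: "0 < q" "w < q" "0 < w" "q \<le> w + pile w"
    using \<open>w \<in> covers q\<close> by (simp_all add: covers_def)
  have card: "card (covers q) = pile q"
    using pile_eq[OF q(1)] chain_step.hyps by simp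
  have sub: "covers q \<subseteq> {w..<q}"
    using chain_step.hyps(3) by (auto simp: covers_def)
  then have "pile q \<le> q - w"
    using card_mono[OF _ sub] card by simp
  then have x: "w < x" "x < q" "q = x + v + 1"
    using chain_step.prems chain_step.hyps(5) by (simp_all add: x_def)
  let ?A = "covers q \<inter> {w<..<x}" and ?B = "{w - v..<w}"
  have lw: "l < w"
    by (rule chain_index) fact
  have "covers q \<subseteq> insert w (?A \<union> {x..<q})"
    using sub by auto
  then have "pile q \<le> card (insert w (?A \<union> {x..<q}))"
    unfolding card[symmetric] by (intro card_mono) auto
  also have "\<dots> \<le> Suc (card ?A + card {x..<q})"
    using card_insert_le_m1[of _ "?A \<union> {x..<q}" w] card_Un_le[of ?A "{x..<q}"]
    by (simp add: card_insert_if)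
  finally have A: "pile q \<le> card ?A + v + 2"
    using x by simp
  have "insert w (?A \<union> ?B) \<subseteq> covers x"
  proof
    fix y
    assume "y \<in> insert w (?A \<union> ?B)"
    then consider "y = w" | "y \<in> ?A" | "w - v \<le> y" "y < w"
      by auto
    then show "y \<in> covers x"
    proof cases
      case 3
      define u where "u = w - 1 - y"
      have u: "u < v" "y = w - 1 - u" "u < l"
        using 3 chain_step.prems by (auto simp: u_def)
      then have "pile w \<le> pile y + 1"
        using chain_step.IH[of u] chain_step.prems by simp
      then have "x \<le> y + pile y"
        using u lw q x by linarith
      moreover have "0 < y"
        using u lw by linarith
      ultimately show ?thesis
        using 3 x by (simp add: covers_def)
    qed (use x q in \<open>auto simp: covers_def\<close>)
  qed
  then have "card (insert w (?A \<union> ?B)) \<le> pile x"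
    by (rule card_covers_le[rotated]) (use x in simp)
  moreover have "card (insert w (?A \<union> ?B)) = Suc (card (?A \<union> ?B))"
    by (rule card_insert_disjoint) auto
  moreover have "card (?A \<union> ?B) = card ?A + card ?B"
    by (rule card_Un_disjoint) auto
  moreover have "card ?B = v"
    using lw chain_step.prems by simp
  ultimately have "pile q \<le> pile x + 1"
    using A by linarith
  then show ?case
    by (simp add: x_def)
qed simp

lemma config_sum_le: "(\<Sum>i<m. (sow ^^ t) c (Suc i)) \<le> mass c"
  using sum_config_le[of "{1..m}" t] by (simp add: sum.atLeast1_atMost_eq)

lemma c_pos_le_mass: "0 < c p \<Longrightarrow> p \<le> mass c"
proof -
  assume p: "0 < c p"
  have "(\<Sum>i<p. 1) \<le> (\<Sum>i<p. c (Suc i))"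
  proof (rule sum_mono)
    fix i
    assume "i \<in> {..<p}"
    then show "1 \<le> c (Suc i)"
      using c_pos_mono[OF p, of "Suc i"] by simp
  qed
  then show ?thesis
    using config_sum_le[where m = p and t = 0] by simp
qed

lemma config_0: "(sow ^^ t) c 0 = 0"
  by (cases t) (simp_all add: c_0 sow_def)

end

text \<open>\<open>h\<close> stands for the last position with a pile below \<open>k\<close>, or 0.
  \<open>h_bound\<close> carries the link between the two chains: the longer small piles survive,
  the more generations lie behind a large pile reaching past \<open>h\<close>.\<close>

locale no_holes = sowing +
  fixes k h :: nat
  assumes k: "2 \<le> k"
    and no_holes: "h < p \<Longrightarrow> k \<le> pile p"
    and h_bound: "chain (k + 2) l q \<Longrightarrow> q \<le> h \<Longrightarrow> h < q + pile q \<Longrightarrow>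
      h \<le> triangular (k - 1) + k * (l + 1)"
begin

lemma config_ge: "h \<le> t \<Longrightarrow> 0 < i \<Longrightarrow> k + 1 - i \<le> (sow ^^ t) c i"
proof -
  assume t: "h \<le> t" "0 < i"
  have "{q \<in> covers (t + i). t < q} \<subseteq> {t<..<t + i}"
    by (auto simp: covers_def)
  then have "card {q \<in> covers (t + i). t < q} \<le> i - 1"
    using card_mono[of "{t<..<t + i}" "{q \<in> covers (t + i). t < q}"] by simp
  moreover have "k \<le> pile (t + i)"
    using t by (intro no_holes) simp
  ultimately show ?thesis
    using pile_split[OF t(2), of t] t(2) by linarith
qed

lemma pile_gt:
  assumes "h + k < x" "w \<in> covers x" "w + k < x"
  shows "k + 1 \<le> pile x"
proof -
  have "insert w {x - k..<x} \<subseteq> covers x"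
  proof
    fix y
    assume "y \<in> insert w {x - k..<x}"
    then consider "y = w" | "x - k \<le> y" "y < x"
      by auto
    then show "y \<in> covers x"
    proof cases
      case 2
      then have "h < y"
        using assms by linarith
      then have "k \<le> pile y"
        by (rule no_holes)
      then show ?thesis
        using 2 \<open>h < y\<close> unfolding covers_def by simp
    qed (use assms in simp)
  qed
  then have "card (insert w {x - k..<x}) \<le> pile x"
    by (rule card_covers_le[rotated]) (use assms in simp)
  then show ?thesis
    using assms by (simp add: card_insert_if)
qed

text \<open>The guard \<open>v \<le> k\<close> lets \<open>a\<close> grow with the position bound
  although only the last \<open>k + 1\<close> piles are controlled.\<close>

definition run :: "nat \<Rightarrow> nat \<Rightarrow> bool" where
  "run q a \<longleftrightarrow> (\<forall>v<a. v \<le> k \<longrightarrow> v + 1 < q \<and> k + 1 \<le> pile (q - 1 - v))"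

text \<open>The \<open>e + 1\<close> piles directly before \<open>q\<close> are covered by
  \<open>w\<close> from a distance above \<open>k\<close>. The others are images of the run:
  \<open>w + k - u\<close> is covered by the \<open>u + 1\<close> run members before
  \<open>w\<close> and by every pile from \<open>w\<close> on.\<close>

lemma run_step:
  assumes w: "h < w" "w \<in> covers q" "q = w + k + 2 + e" and run: "run w a"
  shows "run q (a + 1 + e)"
  unfolding run_def
proof (intro allI impI)
  fix v
  assume v: "v < a + 1 + e" "v \<le> k"
  have wq: "q \<le> w + pile w" "0 < w"
    using w by (simp_all add: covers_def)
  have "k + 1 \<le> pile (q - 1 - v)"
  proof (cases "v \<le> e")
    case True
    have x: "w + k < q - 1 - v" "q - 1 - v < q"
      using True w by linarith+
    then have "w \<in> covers (q - 1 - v)"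
      using wq unfolding covers_def by simp
    then show ?thesis
      using x w(1) by (intro pile_gt) simp_all
  next
    case False
    define u where "u = v - (e + 1)"
    have u: "v = e + 1 + u" "u < a" "u \<le> k"
      using False v by (simp_all add: u_def)
    define x where "x = w + k - u"
    have x: "q - 1 - v = x"
      using u w by (simp add: x_def)
    have r: "y + 1 < w \<and> k + 1 \<le> pile (w - 1 - y)" if "y \<le> u" for y
      using run that u unfolding run_def by simp
    have "{w - 1 - u..<x} \<subseteq> covers x"
    proof
      fix y
      assume y: "y \<in> {w - 1 - u..<x}"
      show "y \<in> covers x"
      proof (cases "w \<le> y")
        case True
        then show ?thesis
          using no_holes[of y] w y wq by (simp add: covers_def x_def)
      next
        case False
        define z where "z = w - 1 - y"
        have "z \<le> u" "y = w - 1 - z"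
          using False y by (auto simp: z_def)
        then have "k + 1 \<le> pile y" "0 < y"
          using r[of z] by simp_all
        then show ?thesis
          using y False r[of u] unfolding covers_def x_def by auto
      qed
    qed
    then have "card {w - 1 - u..<x} \<le> pile x"
      by (rule card_covers_le[rotated]) (use u wq in \<open>simp add: x_def\<close>)
    moreover have "card {w - 1 - u..<x} = k + 1"
      using r[of u] by (simp add: x_def)
    ultimately show ?thesis
      unfolding x by linarith
  qed
  then show "v + 1 < q \<and> k + 1 \<le> pile (q - 1 - v)"
    using v w wq by simp
qed

text \<open>A step back over distance \<open>k + 2 + e\<close> lengthens the run by
  \<open>1 + e\<close>, in pace with the position bound. The trace ends on initial seeds or by
  crossing \<open>h\<close>, where \<open>chain_run\<close> and \<open>h_bound\<close> supply the
  run.\<close>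

lemma large_pile_run:
  "h < q \<Longrightarrow> k + 2 \<le> pile q \<Longrightarrow> \<exists>a. q \<le> triangular k + 1 + (k + 2) * a \<and> run q a"
proof (induction q rule: less_induct)
  case (less q)
  have Tk: "triangular k = triangular (k - 1) + k"
    using k by (intro triangular_pred) simp
  consider (pos) "0 < c q" | (late) w where "c q = 0" "w \<in> covers q" "h < w" "w + k + 2 \<le> q"
    | (early) "c q = 0" "\<forall>w \<in> covers q. h < w \<longrightarrow> q < w + k + 2"
    by (cases "c q = 0") force+
  then show ?case
  proof cases
    case pos
    \<comment> \<open>Beyond \<open>triangular k\<close>, piles with initial seeds have size at
      least \<open>k + 1\<close> by \<open>ones_bound\<close>.\<close>
    define a where "a = q - (triangular k + 1)"
    have "run q a"
      unfolding run_def
    proof (intro allI impI)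
      fix v
      assume v: "v < a"
      then have x: "triangular k < q - 1 - v" "v + 1 < q"
        by (auto simp: a_def)
      then have "0 < c (q - 1 - v)"
        by (intro c_pos_mono[OF pos]) simp_all
      then have "\<not> pile (q - 1 - v) < k + 1"
        using ones_bound[of "q - 1 - v" "k + 1"] x by auto
      then show "v + 1 < q \<and> k + 1 \<le> pile (q - 1 - v)"
        using x by simp
    qed
    moreover have "q \<le> triangular k + 1 + (k + 2) * a"
      by (simp add: a_def)
    ultimately show ?thesis
      by blast
  next
    case late
    define e where "e = q - (w + k + 2)"
    have q: "q = w + k + 2 + e"
      using late by (simp add: e_def)
    have "k + 2 \<le> pile w"
      using late q by (simp add: covers_def)
    then obtain a where a: "w \<le> triangular k + 1 + (k + 2) * a" "run w a"
      using less.IH[of w] late by (auto simp: covers_def)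
    have "run q (a + 1 + e)"
      using run_step[OF late(3,2) q a(2)] .
    moreover have "q \<le> triangular k + 1 + (k + 2) * (a + 1 + e)"
      using a(1) q by (simp add: algebra_simps)
    ultimately show ?thesis
      by blast
  next
    case early
    have "0 < q"
      using less.prems by simp
    then obtain l where l: "chain (k + 2) l q"
      using chain_exists[of "k + 2" q] less.prems by auto
    from l obtain l' w where w: "l = Suc l'" "chain (k + 2) l' w" "w \<in> covers q"
        "\<forall>x \<in> covers q. w \<le> x"
      by (cases rule: chain.cases) (use early in simp, blast)
    have "covers q \<subseteq> {w..<q}"
      using w by (auto simp: covers_def)
    then have "card (covers q) \<le> q - w"
      using card_mono[of "{w..<q}" "covers q"] by simp
    then have wq: "w + k + 2 \<le> q"
      using less.prems pile_eq[OF \<open>0 < q\<close>] early by simp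
    then have wh: "w \<le> h"
      using early(2) w(3) by (meson not_less)
    have "h < w + pile w"
      using less.prems w(3) by (simp add: covers_def)
    then have h: "h \<le> triangular (k - 1) + k * l"
      using h_bound[OF w(2) wh] w(1) by simp
    \<comment> \<open>Two sources of the run: the piles before \<open>q\<close> given by the chain,
      and the piles beyond \<open>h + k\<close>, which \<open>w\<close> covers on top of their
      \<open>k\<close> predecessors.\<close>
    define a where "a = max l (q - 1 - h - k)"
    have "run q a"
      unfolding run_def
    proof (intro allI impI)
      fix v
      assume v: "v < a" "v \<le> k"
      show "v + 1 < q \<and> k + 1 \<le> pile (q - 1 - v)"
      proof (cases "v < l")
        case True
        then show ?thesis
          using chain_run[OF l True] chain_index[OF l] v less.prems by simp
      next
        case False
        then have "v < q - 1 - h - k"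
          using v by (simp add: a_def max_def split: if_splits)
        then have x: "h + k < q - 1 - v"
          by simp
        then have "w \<in> covers (q - 1 - v)"
          using w(3) wh unfolding covers_def by auto
        then have "k + 1 \<le> pile (q - 1 - v)"
          using x wh by (intro pile_gt[of _ w]) simp_all
        then show ?thesis
          using x by simp
      qed
    qed
    moreover have "q \<le> triangular k + 1 + (k + 2) * a"
    proof -
      have "q \<le> h + k + 1 + a"
        unfolding a_def by linarith
      also have "\<dots> \<le> triangular (k - 1) + k * a + k + 1 + a"
        using h mult_le_mono2[of l a k] unfolding a_def by linarith
      also have "\<dots> \<le> triangular k + 1 + (k + 2) * a"
        by (simp add: Tk)
      finally show ?thesis .
    qed
    ultimately show ?thesis
      by blast
  qed
qed

text \<open>Count the seeds just before \<open>q\<close> is sown: the first entry is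
  \<open>pile q\<close>, and the next \<open>k\<close> entries dominate a staircase raised by one
  wherever the run reaches.\<close>

lemma mass_ge_run:
  assumes q: "h < q" "k + 2 + e \<le> pile q" and run: "run q a"
  shows "triangular k + 2 + e + min a k \<le> mass c"
proof -
  define t where "t = q - 1"
  have t: "h \<le> t" "q = Suc t"
    using q by (simp_all add: t_def)
  have "(\<Sum>v<k. v + (if v < a then 1 else 0))
      = (\<Sum>j<k. (k - Suc j) + (if k - Suc j < a then 1 else 0))"
    by (rule sum.nat_diff_reindex[symmetric])
  also have "\<dots> \<le> (\<Sum>j<k. (sow ^^ t) c (Suc (Suc j)))"
  proof (rule sum_mono)
    fix j
    assume j: "j \<in> {..<k}"
    define v where "v = k - Suc j"
    have jk: "k = Suc (j + v)"
      using j by (simp add: v_def)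
    show "(k - Suc j) + (if k - Suc j < a then 1 else 0) \<le> (sow ^^ t) c (Suc (Suc j))"
    proof (cases "v < a")
      case False
      then show ?thesis
        using config_ge[OF t(1), of "Suc (Suc j)"] by (simp flip: v_def add: jk)
    next
      case True
      have r: "u + 1 < q \<and> k + 1 \<le> pile (q - 1 - u)" if "u \<le> v" for u
        using run True that jk unfolding run_def by simp
      let ?S = "{y. 0 < y \<and> y \<le> t \<and> t + Suc (Suc j) \<le> y + pile y}"
      have "{t - v..t} \<subseteq> ?S"
      proof
        fix y
        assume y: "y \<in> {t - v..t}"
        define u where "u = t - y"
        have "u \<le> v" "y = q - 1 - u"
          using y t by (auto simp: u_def)
        then have "u + 1 < q" "k + 1 \<le> pile y"
          using r by simp_all
        then show "y \<in> ?S"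
          using y \<open>y = q - 1 - u\<close> \<open>u \<le> v\<close> t jk by simp
      qed
      moreover have "finite ?S"
        by (rule finite_subset[of _ "{..t}"]) auto
      ultimately have "card {t - v..t} \<le> card ?S"
        by (intro card_mono)
      moreover have "card {t - v..t} = v + 1"
        using r[of v] t by simp
      ultimately show ?thesis
        using config_eq[of "Suc (Suc j)" t] True by (simp flip: v_def)
    qed
  qed
  finally have "(\<Sum>v<k. v + (if v < a then 1 else 0)) \<le> (\<Sum>j<k. (sow ^^ t) c (Suc (Suc j)))" .
  moreover have "(sow ^^ t) c (Suc 0) + (\<Sum>j<k. (sow ^^ t) c (Suc (Suc j))) \<le> mass c"
    using config_sum_le[where m = "Suc k" and t = t] by (simp only: sum.lessThan_Suc_shift)
  moreover have "pile q = (sow ^^ t) c (Suc 0)"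
    by (simp add: pile_def t)
  ultimately show ?thesis
    using q(2) sum_indicator_reversed[where k = k and a = a] by linarith
qed

lemma large_pile_bound:
  assumes mass: "mass c = triangular k + r" and r: "r \<le> k"
    and q: "h < q" "k + 2 + e \<le> pile q"
  shows "2 \<le> r \<and> q + e \<le> triangular k + 1 + (k + 2) * (r - 2)"
proof -
  obtain a where a: "q \<le> triangular k + 1 + (k + 2) * a" "run q a"
    using large_pile_run[of q] q by auto
  have "2 + e + min a k \<le> r"
    using mass_ge_run[OF q a(2)] mass by simp
  then have ar: "2 + e + a \<le> r"
    using r by (simp add: min_def split: if_splits)
  have "q + e \<le> triangular k + 1 + (k + 2) * (a + e)"
    using a by (simp add: algebra_simps)
  also have "\<dots> \<le> triangular k + 1 + (k + 2) * (r - 2)"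
    using ar by (intro add_left_mono mult_le_mono2) simp
  finally show ?thesis
    using ar by simp
qed

text \<open>At time \<open>h\<close> every entry up to \<open>k + 2 + \<delta>\<close> holds a seed
  of \<open>q\<close>, which bounds \<open>\<delta>\<close>. The piles that \<open>chain_run\<close>
  places before \<open>q\<close> raise the staircase in up to \<open>l\<close> entries; with entries
  \<open>k + 1\<close> and \<open>k + 2\<close> this gives \<open>l + 2 \<le> r\<close>, and
  \<open>h_bound\<close> turns it into a bound on \<open>h\<close>.\<close>

lemma early_pile_bound:
  assumes mass: "mass c = triangular k + r" and r: "r \<le> k"
    and q: "0 < q" "q \<le> h" "h + \<delta> + k + 2 \<le> q + pile q"
  shows "2 \<le> r \<and> h + \<delta> + 1 \<le> triangular (k - 1) + (k + 2) * (r - 1)"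
proof -
  have one: "1 \<le> (sow ^^ h) c i" if "0 < i" "i \<le> k + 2 + \<delta>" for i
  proof -
    have "q \<in> {y. 0 < y \<and> y \<le> h \<and> h + i \<le> y + pile y}" (is "_ \<in> ?S")
      using q that by simp
    moreover have "finite ?S"
      by (rule finite_subset[of _ "{..h}"]) auto
    ultimately have "0 < card ?S"
      using card_gt_0_iff by blast
    then show ?thesis
      using config_eq[OF that(1), of h] by linarith
  qed
  have "triangular k + (2 + \<delta>) = (\<Sum>i<k + (2 + \<delta>). (k - i) + (if k \<le> i then 1 else 0))"
    by (rule sum_staircase[symmetric])
  also have "\<dots> \<le> (\<Sum>i<k + (2 + \<delta>). (sow ^^ h) c (Suc i))"
  proof (rule sum_mono)
    fix i
    assume "i \<in> {..<k + (2 + \<delta>)}"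
    then show "(k - i) + (if k \<le> i then 1 else 0) \<le> (sow ^^ h) c (Suc i)"
      using one[of "Suc i"] config_ge[of h "Suc i"] by simp
  qed
  also have "\<dots> \<le> mass c"
    by (rule config_sum_le)
  finally have \<delta>: "2 + \<delta> \<le> r"
    by (simp add: mass)
  obtain l where l: "chain (k + 2) l q"
    using chain_exists[of "k + 2" q] q by auto
  have h: "h \<le> triangular (k - 1) + k * (l + 1)"
    by (rule h_bound[OF l q(2)]) (use q in simp)
  have "(\<Sum>v<k. Suc (v + (if v < l then 1 else 0)))
      = (\<Sum>j<k. Suc ((k - Suc j) + (if k - Suc j < l then 1 else 0)))"
    by (rule sum.nat_diff_reindex[symmetric])
  also have "\<dots> \<le> (\<Sum>j<k. (sow ^^ h) c (Suc j))"
  proof (rule sum_mono)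
    fix j
    assume j: "j \<in> {..<k}"
    define v where "v = k - Suc j"
    have jk: "k = Suc (j + v)"
      using j by (simp add: v_def)
    show "Suc ((k - Suc j) + (if k - Suc j < l then 1 else 0)) \<le> (sow ^^ h) c (Suc j)"
    proof (cases "v < l")
      case False
      then show ?thesis
        using config_ge[of h "Suc j"] by (simp flip: v_def add: jk)
    next
      case True
      let ?S = "{y. 0 < y \<and> y \<le> h \<and> h + Suc j \<le> y + pile y}"
      have lq: "l < q"
        by (rule chain_index) fact
      have "{q - 1 - v..q} \<subseteq> ?S"
      proof
        fix y
        assume y: "y \<in> {q - 1 - v..q}"
        show "y \<in> ?S"
        proof (cases "y = q")
          case True
          then show ?thesis
            using q jk by simp
        next
          case False
          define u where "u = q - 1 - y"
          have u: "u \<le> v" "y = q - 1 - u"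
            using y False by (auto simp: u_def)
          then have "pile q \<le> pile y + 1"
            using chain_run[OF l, of u] True jk by simp
          then have "h + Suc j \<le> y + pile y"
            using q(3) u jk lq True by linarith
          then show ?thesis
            using u lq True q(2) by simp
        qed
      qed
      moreover have "finite ?S"
        by (rule finite_subset[of _ "{..h}"]) auto
      ultimately have "card {q - 1 - v..q} \<le> card ?S"
        by (intro card_mono)
      moreover have "card {q - 1 - v..q} = v + 2"
        using lq True by simp
      ultimately show ?thesis
        using config_eq[of "Suc j" h] True by (simp flip: v_def)
    qed
  qed
  finally have "(\<Sum>v<k. Suc (v + (if v < l then 1 else 0))) \<le> (\<Sum>j<k. (sow ^^ h) c (Suc j))" .
  moreover have "(\<Sum>v<k. Suc (v + (if v < l then 1 else 0))) = triangular k + min l k"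
    using sum_indicator_reversed[where k = k and a = l] by (simp only: sum_Suc card_lessThan)
  moreover have "(\<Sum>j<k. (sow ^^ h) c (Suc j)) + 2 \<le> mass c"
    using config_sum_le[where m = "Suc (Suc k)" and t = h] one[of "k + 1"] one[of "k + 2"] by simp
  ultimately have "l + 2 \<le> r"
    using mass r by (simp add: min_def split: if_splits)
  then have "k * (l + 1) \<le> k * (r - 1)"
    by (intro mult_le_mono2) simp
  moreover have "(k + 2) * (r - 1) = k * (r - 1) + 2 * (r - 1)"
    by (rule add_mult_distrib)
  ultimately show ?thesis
    using h \<delta> by linarith
qed

lemma config_le:
  assumes mass: "mass c = triangular k + r" and r: "r \<le> k"
    and t: "h \<le> t" "triangular (k - 1) + (k + 2) * (r - 1) \<le> t"
  shows "(sow ^^ t) c i \<le> marching_group (k + 1) i"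
proof -
  have Tk: "triangular k = triangular (k - 1) + k"
    using k by (intro triangular_pred) simp
  \<comment> \<open>The bound on \<open>p\<close> is one less than the second lower bound on
    \<open>t\<close>.\<close>
  have late: "p < t" if p: "2 \<le> r \<and> p \<le> triangular k + 1 + (k + 2) * (r - 2)" for p
  proof -
    have "r - 1 = Suc (r - 2)"
      using p by linarith
    then have "triangular (k - 1) + (k + 2) + (k + 2) * (r - 2) \<le> t"
      using t by simp
    then show ?thesis
      using p Tk by linarith
  qed
  consider (zero) "i = 0" | (low) "0 < i" "i \<le> k + 1" | (high) "k + 1 < i"
    by linarith
  then show ?thesis
  proof cases
    case zero
    then show ?thesis
      by (simp add: config_0)
  next
    case low
    show ?thesis
    proof (rule ccontr)
      assume "\<not> ?thesis"
      then have large: "k + 3 - i \<le> (sow ^^ t) c i"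
        using low by (simp add: marching_group_def)
      have "{t<..<t + i} \<subseteq> {q \<in> covers (t + i). t < q}"
      proof
        fix q
        assume q: "q \<in> {t<..<t + i}"
        then have "k \<le> pile q"
          using t by (intro no_holes) simp
        then show "q \<in> {q \<in> covers (t + i). t < q}"
          using q low unfolding covers_def by auto
      qed
      then have "card {t<..<t + i} \<le> card {q \<in> covers (t + i). t < q}"
        by (intro card_mono) simp_all
      then have "k + 2 + 0 \<le> pile (t + i)"
        using pile_split[OF low(1), of t] large low by simp
      then have "2 \<le> r \<and> t + i + 0 \<le> triangular k + 1 + (k + 2) * (r - 2)"
        using t low by (intro large_pile_bound[OF mass r]) simp_all
      then show False
        using late[of "t + i"] by (metis add_0_right not_add_less1)
    qed
  next
    case high
    have "\<not> 0 < c (t + i)"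
    proof
      assume "0 < c (t + i)"
      then have le: "t + i \<le> triangular (k - 1) + k + r"
        using c_pos_le_mass[of "t + i"] mass Tk by simp
      have "r - 1 \<le> (k + 2) * (r - 1)"
        by simp
      then show False
        using le t high by linarith
    qed
    moreover have "{q. 0 < q \<and> q \<le> t \<and> t + i \<le> q + pile q} = {}"
    proof (rule equals0I)
      fix q
      assume "q \<in> {q. 0 < q \<and> q \<le> t \<and> t + i \<le> q + pile q}"
      then have q: "0 < q" "q \<le> t" "t + i \<le> q + pile q"
        by simp_all
      show False
      proof (cases "h < q")
        case True
        \<comment> \<open>The reach still left at time \<open>t\<close> enters as \<open>e\<close>,
          so that \<open>large_pile_bound\<close> limits \<open>t\<close> itself.\<close>
        have "k + 2 + (t - q) \<le> pile q"
          using q high by linarith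
        then have "2 \<le> r \<and> q + (t - q) \<le> triangular k + 1 + (k + 2) * (r - 2)"
          by (rule large_pile_bound[OF mass r True])
        then show False
          using late[of t] q(2) by (metis le_add_diff_inverse less_irrefl)
      next
        case False
        have "2 \<le> r \<and> h + (t - h) + 1 \<le> triangular (k - 1) + (k + 2) * (r - 1)"
          using False q high t by (intro early_pile_bound[OF mass r, of q]) simp_all
        then show False
          using t le_add_diff_inverse[OF t(1)] by linarith
      qed
    qed
    ultimately have "(sow ^^ t) c i = 0"
      using config_eq[of i t] high by simp
    then show ?thesis
      by simp
  qed
qed

end

section \<open>Bounds on the depth\<close>

lemma sum_marching_group: "(\<Sum>i<k. marching_group k (Suc i)) = triangular k"
proof -
  have "(\<Sum>i<k. marching_group k (Suc i)) = (\<Sum>i<k. k - i)"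
    by (rule sum.cong) (simp_all add: marching_group_def)
  also have "\<dots> = (\<Sum>i<k. (k - i) + (if k \<le> i then 1 else 0))"
    by (rule sum.cong) simp_all
  finally show ?thesis
    using sum_staircase[where k = k and m = 0] by simp
qed

text \<open>The seed count for small piles needs a surplus below \<open>k / 2\<close>, which
  \<open>r\<close> may exceed; \<open>r'\<close> is a portion of it that qualifies.\<close>

lemma (in sowing) augmented_eventually:
  assumes mass: "mass c = triangular k + r" and kr: "2 \<le> k" "r \<le> k"
    and r': "2 * r' < k" "r' \<le> r"
    and t: "triangular (k - 1) + k * (k - 1 - r') \<le> t" "triangular (k - 1) + (k + 2) * (r - 1) \<le> t"
  shows "augmented_marching_group ((sow ^^ t) c)"
proof -
  have mass_r': "triangular k + r' \<le> mass c" and mass_0: "triangular k + 0 \<le> mass c"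
    using mass r' by simp_all
  have hole_le: "p \<le> t" if p: "0 < p" "pile p < k" for p
  proof -
    have "p \<le> triangular (k - 1) + k * (k - 1 - r')"
      using hole_invariant[OF mass_r' r'(1) kr(1) p le_refl]
    proof (elim disjE conjE exE)
      fix \<beta>
      assume \<beta>: "p \<le> triangular (k - 1) + k * \<beta>" "k = k \<longrightarrow> \<beta> + r' + 1 \<le> k"
      then have "k * \<beta> \<le> k * (k - 1 - r')"
        by (intro mult_le_mono2) simp
      then show ?thesis
        using \<beta>(1) by linarith
    qed simp
    then show ?thesis
      using t by simp
  qed
  define H where "H = insert 0 {p. 0 < p \<and> pile p < k}"
  define h where "h = Max H"
  have "H \<subseteq> {..t}"
    using hole_le by (auto simp: H_def)
  then have fin: "finite H"
    by (rule finite_subset) simp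
  have "h \<in> H"
    unfolding h_def by (rule Max_in[OF fin]) (simp add: H_def)
  then have ht: "h \<le> t" and h: "h = 0 \<or> 0 < h \<and> pile h < k"
    using \<open>H \<subseteq> {..t}\<close> by (auto simp: H_def)
  interpret no_holes c k h
  proof
    show "2 \<le> k"
      by (rule kr(1))
    show "k \<le> pile p" if "h < p" for p
    proof (rule ccontr)
      assume "\<not> k \<le> pile p"
      then have "p \<in> H"
        using that by (simp add: H_def)
      then have "p \<le> h"
        unfolding h_def by (rule Max_ge[OF fin])
      then show False
        using that by simp
    qed
    show "h \<le> triangular (k - 1) + k * (l + 1)"
      if q: "chain (k + 2) l q" "q \<le> h" "h < q + pile q" for l q
    proof -
      \<comment> \<open>Here the clause on chains replaces the seed count, so the instance with
        surplus 0 is enough.\<close>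
      have "2 * 0 < k" "0 < h" "pile h < k"
        using h q chain_pos[OF q(1)] kr by auto
      from hole_invariant[OF mass_0 this(1) kr(1) this(2,3) le_refl]
      show ?thesis
      proof (elim disjE conjE exE)
        fix \<beta>
        assume \<beta>: "h \<le> triangular (k - 1) + k * \<beta>"
          "\<forall>l q. chain (k + 2) l q \<longrightarrow> h < q + pile q \<longrightarrow> \<beta> \<le> l + 1"
        then have "k * \<beta> \<le> k * (l + 1)"
          using q by (intro mult_le_mono2) blast
        then show ?thesis
          using \<beta>(1) by linarith
      qed (use kr in simp_all)
    qed
  qed
  let ?f = "(sow ^^ t) c"
  have "marching_group k \<le> ?f"
  proof (rule le_funI)
    fix i
    show "marching_group k i \<le> ?f i"
      using config_ge[OF ht, of i] by (auto simp: marching_group_def)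
  qed
  moreover have "?f \<le> marching_group (k + 1)"
    using config_le[OF mass kr(2) ht t(2)] by (rule le_funI)
  moreover have "?f \<noteq> marching_group (k + 1)"
  proof
    assume eq: "?f = marching_group (k + 1)"
    have "triangular (k + 1) = (\<Sum>i<k + 1. marching_group (k + 1) (Suc i))"
      by (rule sum_marching_group[symmetric])
    also have "\<dots> \<le> mass c"
      using config_sum_le[where m = "k + 1" and t = t] by (simp only: eq)
    finally show False
      using mass kr by simp
  qed
  ultimately show ?thesis
    unfolding augmented_marching_group_def using mancala_funpow_sow(1)[OF mancala]
    by (auto simp: less_le)
qed

section \<open>Monotonicity of sowing and confinement between marching groups\<close>

lemma sow_mono: "f \<le> g \<Longrightarrow> sow f \<le> sow g"
proof (rule le_funI)
  fix i
  assume le: "f \<le> g"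
  then show "sow f i \<le> sow g i"
    using le_funD[OF le, of 1] le_funD[OF le, of "i + 1"] by (simp add: sow_def)
qed

lemma sow_marching_group: "sow (marching_group k) = marching_group k"
proof
  fix i
  show "sow (marching_group k) i = marching_group k i"
    by (cases "i = k") (auto simp: sow_def marching_group_def)
qed

lemma funpow_sow_mono: "f \<le> g \<Longrightarrow> (sow ^^ t) f \<le> (sow ^^ t) g"
  by (induction t) (simp_all add: sow_mono)

lemma funpow_sow_marching_group: "(sow ^^ t) (marching_group k) = marching_group k"
  by (induction t) (simp_all add: sow_marching_group)

lemma triangular_le_cancel: "triangular i < triangular j \<Longrightarrow> i < j"
  using triangular_mono[of j i] by (meson not_less)

text \<open>The sandwich places the mass between consecutive triangular numbers, which determines
  the order of the lower marching group.\<close>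

lemma (in sowing) augmented_level:
  assumes mass: "mass c = triangular k + r" "r \<le> k" and aug: "augmented_marching_group c"
  shows "marching_group k \<le> c \<and> c \<le> marching_group (k + 1)"
proof -
  obtain j where j: "marching_group j \<le> c" "c < marching_group (j + 1)"
    using aug unfolding augmented_marching_group_def by blast
  have "triangular j \<le> (\<Sum>i<j. c (Suc i))"
    unfolding sum_marching_group[symmetric] by (intro sum_mono le_funD[OF j(1)])
  also have "\<dots> \<le> mass c"
    using config_sum_le[where m = j and t = 0] by simp
  also have "\<dots> < triangular (k + 1)"
    using mass by simp
  finally have "j \<le> k"
    using triangular_le_cancel[of j "k + 1"] by simp
  have le: "c \<le> marching_group (j + 1)"
    using j(2) by (simp add: less_le)
  have beyond: "c (j + 2) = 0"
    using le_funD[OF le, of "j + 2"] by (simp add: marching_group_def)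
  obtain i where i: "c i < marching_group (j + 1) i"
    using j(2) by (metis le_fun_def less_le_not_le not_le)
  then obtain i' where i': "i = Suc i'" "i' < j + 1"
    by (cases i) (auto simp: marching_group_def split: if_splits)
  have "mass c = (\<Sum>s=1..<j + 2. c s)"
    using mass_eq_sum_config[of 0 "j + 2"] beyond by simp
  also have "\<dots> = (\<Sum>i<j + 1. c (Suc i))"
    using sum.atLeast1_atMost_eq[of c "j + 1"] by (simp add: atLeastLessThanSuc_atLeastAtMost)
  also have "\<dots> < (\<Sum>i<j + 1. marching_group (j + 1) (Suc i))"
    by (rule sum_strict_mono_ex1) (use i i' le_funD[OF le] in auto)
  also have "\<dots> = triangular (j + 1)"
    by (rule sum_marching_group)
  finally have "k < j + 1"
    using mass triangular_le_cancel[of k "j + 1"] by simp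
  then have "j = k"
    using \<open>j \<le> k\<close> by simp
  then show ?thesis
    using j le by simp
qed

lemma (in sowing) augmented_persists:
  assumes mass: "mass c = triangular k + r" "r \<le> k"
    and aug: "augmented_marching_group ((sow ^^ s) c)" and st: "s \<le> t"
  shows "marching_group k \<le> (sow ^^ t) c \<and> (sow ^^ t) c \<le> marching_group (k + 1)"
proof -
  let ?g = "(sow ^^ s) c"
  have g: "mancala ?g" "mass ?g = triangular k + r"
    using mancala_funpow_sow[OF mancala] mass by simp_all
  have "marching_group k \<le> ?g \<and> ?g \<le> marching_group (k + 1)"
    by (rule sowing.augmented_level[OF sowing.intro[OF g(1)] g(2) mass(2) aug])
  then have "(sow ^^ (t - s)) (marching_group k) \<le> (sow ^^ (t - s)) ?g
    \<and> (sow ^^ (t - s)) ?g \<le> (sow ^^ (t - s)) (marching_group (k + 1))"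
    by (simp add: funpow_sow_mono)
  moreover have "(sow ^^ (t - s)) ?g = (sow ^^ t) c"
    using st by (simp add: funpow_add[symmetric] flip: comp_apply[of "sow ^^ (t - s)" "sow ^^ s" c])
  ultimately show ?thesis
    by (simp only: funpow_sow_marching_group)
qed

lemma (in sowing) less_depth:
  assumes mass: "mass c = triangular k + r" "r \<le> k" "2 \<le> k"
    and neg: "\<not> (marching_group k \<le> (sow ^^ t) c \<and> (sow ^^ t) c \<le> marching_group (k + 1))"
  shows "t < depth c"
proof (rule ccontr)
  assume "\<not> t < depth c"
  then have le: "depth c \<le> t"
    by simp
  \<comment> \<open>A time at which \<open>augmented_eventually\<close> applies with
    \<open>r' = 0\<close>, so that the least such time exists.\<close>
  let ?u = "triangular (k - 1) + k * (k - 1 - 0) + (k + 2) * (r - 1)"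
  have "augmented_marching_group ((sow ^^ ?u) c)"
    by (rule augmented_eventually[OF mass(1,3,2), of 0]) (use mass in simp_all)
  then have "augmented_marching_group ((sow ^^ depth c) c)"
    unfolding depth_def by (rule LeastI)
  then show False
    using augmented_persists[OF mass(1,2) _ le] neg by blast
qed

lemma finite_configs: "finite (configs n)"
proof (rule finite_subset)
  let ?F = "{f. \<forall>i. (i \<in> {1..n} \<longrightarrow> f i \<in> {..n}) \<and> (i \<notin> {1..n} \<longrightarrow> f i = (0 :: nat))}"
  show "finite ?F"
    by (rule finite_set_of_finite_funs) simp_all
  show "configs n \<subseteq> ?F"
  proof
    fix c
    assume "c \<in> configs n"
    then have c: "mancala c" "mass c = n"
      by (simp_all add: configs_def)
    then interpret sowing c
      by unfold_locales
    have "c i \<le> n \<and> (c i \<noteq> 0 \<longrightarrow> 0 < i \<and> i \<le> n)" for i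
      using sum_le_mass[OF c(1), of "{i}"] c_pos_le_mass[of i] c(2) c_0 by (cases "i = 0") auto
    then show "c \<in> ?F"
      by (simp add: Suc_le_eq) (metis not_gr_zero)
  qed
qed

lemma max_depth_eqI:
  assumes le: "\<And>c. mancala c \<Longrightarrow> mass c = n \<Longrightarrow> depth c \<le> D"
    and ge: "mancala c" "mass c = n" "D \<le> depth c"
  shows "max_depth n = D"
proof -
  have "depth c = D"
    using le[OF ge(1,2)] ge(3) by (rule le_antisym)
  then show ?thesis
    unfolding max_depth_def using le ge finite_configs
    by (intro Max_eqI) (auto simp: configs_def)
qed

section \<open>Extremal configurations\<close>

text \<open>The initial ones delay the growth of the piles; the next \<open>k - 1\<close> positions
  open a window that ends in a pile below \<open>k\<close>, with the surplus placed at its start so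
  that this hole recurs with period \<open>k\<close>.\<close>

definition hole_config :: "nat \<Rightarrow> nat \<Rightarrow> nat \<Rightarrow> nat \<Rightarrow> nat" where
  "hole_config k m e i =
    (if i = 0 \<or> triangular (k - 1) + k \<le> i then 0
     else 1 + (if triangular (k - 1) < i \<and> i \<le> triangular (k - 1) + m then 1 else 0)
            + (if i = triangular (k - 1) + 1 then e else 0))"

text \<open>The surplus over \<open>triangular k\<close> is \<open>m + e - 1\<close>. The instances
  are \<open>m = r + 1\<close>, \<open>e = 0\<close> for \<open>2 * r < k\<close> and
  \<open>m = r\<close>, \<open>e = 1\<close> for \<open>2 * r = k\<close>.\<close>

locale hole_family =
  fixes k m e :: nat
  assumes k: "2 \<le> k" and m: "0 < m" "m < k" and e: "e = 0 \<or> e = 1 \<and> k = 2 * m"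

sublocale hole_family \<subseteq> sowing "hole_config k m e"
proof
  show "mancala (hole_config k m e)"
    unfolding mancala_def using k
    by (intro exI[of _ "triangular (k - 1) + k - 1"]) (auto simp: hole_config_def)
qed

context hole_family
begin

lemma mass_hole_config: "mass (hole_config k m e) = triangular (k - 1) + (k - 1) + m + e"
proof -
  let ?P = "triangular (k - 1)"
  have "mass (hole_config k m e) = (\<Sum>s=1..<?P + k. hole_config k m e s)"
    using mass_eq_sum_config[of 0 "?P + k"] k by (simp add: hole_config_def)
  also have "\<dots> = (\<Sum>s=1..<1 + ?P. hole_config k m e s) + (\<Sum>s=1 + ?P..<k + ?P. hole_config k m e s)"
    using k by (subst sum.atLeastLessThan_concat) (simp_all add: add.commute)
  also have "(\<Sum>s=1..<1 + ?P. hole_config k m e s) = (\<Sum>s=1..<1 + ?P. 1)"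
    using k by (intro sum.cong) (simp_all add: hole_config_def)
  also have "(\<Sum>s=1 + ?P..<k + ?P. hole_config k m e s) = (\<Sum>s=1..<k. hole_config k m e (s + ?P))"
    by (rule sum.shift_bounds_nat_ivl)
  also have "\<dots> = (\<Sum>s=1..<k. 1 + (if s \<le> m then 1 else 0) + (if s = 1 then e else 0))"
    by (intro sum.cong) (simp_all add: hole_config_def)
  also have "\<dots> = (k - 1) + m + e"
  proof -
    have "(\<Sum>s=1..<Suc n. 1 + (if s \<le> m then 1 else 0) + (if s = 1 then e else 0))
      = n + min m n + (if n = 0 then 0 else e)" for n
      by (induction n) auto
    from this[of "k - 1"] show ?thesis
      using k m by simp
  qed
  finally show ?thesis
    by simp
qed

text \<open>Counterpart to \<open>ones_bound\<close>: piles up to \<open>triangular i\<close> have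
  size at most \<open>i\<close>, so the next \<open>i + 1\<close> positions get at most
  \<open>i\<close> covers besides their own seed.\<close>

lemma pile_ones: "0 < p \<Longrightarrow> p \<le> triangular j \<Longrightarrow> j < k \<Longrightarrow> pile p \<le> j"
proof (induction j arbitrary: p)
  case (Suc i)
  show ?case
  proof (cases "p \<le> triangular i")
    case True
    then show ?thesis
      using Suc.IH[of p] Suc.prems by simp
  next
    case False
    have "covers p \<subseteq> {p - i..<p}"
    proof
      fix q
      assume q: "q \<in> covers p"
      have "pile q \<le> i" if "q \<le> triangular i"
        using q Suc.IH[of q] Suc.prems that by (simp add: covers_def)
      then show "q \<in> {p - i..<p}"
        using q Suc.prems by (cases "q \<le> triangular i") (auto simp: covers_def)
    qed
    then have "card (covers p) \<le> i"
      using card_mono[of "{p - i..<p}" "covers p"] by simp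
    moreover have "hole_config k m e p = 1"
    proof -
      have "triangular (Suc i) \<le> triangular (k - 1)"
        using Suc.prems by (intro triangular_mono) simp
      then show ?thesis
        using Suc.prems k by (simp add: hole_config_def)
    qed
    ultimately show ?thesis
      using pile_eq[OF Suc.prems(1)] by simp
  qed
qed simp

text \<open>Past the initial ones, the piles are bounded in windows of length \<open>k\<close> whose last slot admits only
  \<open>k - 1\<close> seeds. With each window the block of \<open>m\<close> slots with a surplus seed moves on by one slot, and
  the extra seed present if \<open>e = 1\<close> moves on by two.\<close>

definition slot :: "nat \<Rightarrow> nat \<Rightarrow> nat" where
  "slot j s = (if s = k then 0
    else 1 + (if j < s \<and> s \<le> j + m then 1 else 0) + (if s = 2 * j + 1 then e else 0))"

lemma slot_le: "slot j s \<le> 3"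
proof -
  have "e \<le> 1"
    using e by auto
  then show ?thesis
    by (simp add: slot_def)
qed

lemma slot_ge_3: "3 \<le> slot j s \<Longrightarrow> e = 1 \<and> s = 2 * j + 1"
proof -
  assume s: "3 \<le> slot j s"
  then have "s = 2 * j + 1" "1 \<le> e"
    by (auto simp: slot_def split: if_splits)
  then show ?thesis
    using e by simp
qed

text \<open>The extra seed at slot \<open>2 * j + 1\<close> lies within the block while
  \<open>j + 1 < m\<close>, which follows from \<open>k = 2 * m\<close>.\<close>

lemma slot_ge_2:
  assumes "2 \<le> slot j s" "j + 1 + m < k"
  shows "j < s \<and> s \<le> j + m"
proof (cases "e = 1 \<and> s = 2 * j + 1")
  case True
  then have "k = 2 * m"
    using e by simp
  then show ?thesis
    using True assms(2) by simp
next
  case False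
  then have "(if s = 2 * j + 1 then e else 0) = 0"
    using e by auto
  then show ?thesis
    using assms(1) by (simp add: slot_def split: if_splits)
qed

lemma pile_window:
  "p = triangular (k - 1) + k * j + s \<Longrightarrow> 0 < s \<Longrightarrow> s \<le> k \<Longrightarrow> j + m < k \<Longrightarrow>
    pile p \<le> k - 1 + slot j s"
proof (induction p arbitrary: j s rule: less_induct)
  case (less p)
  let ?P = "triangular (k - 1)"
  have p: "0 < p"
    using less.prems by simp
  have ones: "pile q \<le> k - 1" if "0 < q" "q \<le> ?P" for q
    using pile_ones[OF that] k by simp
  show ?case
  proof (cases j)
    case 0
    have "covers p \<subseteq> {p - (k - 1)..<p}"
    proof
      fix q
      assume q: "q \<in> covers p"
      then have "0 < q" "q < p" "p \<le> q + pile q"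
        by (simp_all add: covers_def)
      moreover from this have "p \<le> q + (k - 1)"
        using ones[of q] less.prems 0 by (cases "q \<le> ?P") simp_all
      ultimately show "q \<in> {p - (k - 1)..<p}"
        by auto
    qed
    then have "card (covers p) \<le> k - 1"
      using card_mono[of "{p - (k - 1)..<p}" "covers p"] by simp
    moreover have "hole_config k m e p = slot 0 s"
      using less.prems 0 k by (auto simp: hole_config_def slot_def)
    ultimately show ?thesis
      using pile_eq[OF p] 0 by simp
  next
    case (Suc i)
    have c: "hole_config k m e p = 0"
      using less.prems Suc by (simp add: hole_config_def)
    have IH: "pile q \<le> k - 1 + slot j' s'"
      if "q = ?P + k * j' + s'" "0 < s'" "s' \<le> k" "j' \<le> i" "q < p" for q j' s'
      using less.IH[of q j' s'] that less.prems Suc by simp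
    \<comment> \<open>Besides the \<open>k - 1\<close> nearest piles, covers can only sit at
      distance \<open>k\<close>, \<open>k + 1\<close> or \<open>k + 2\<close>; they need a slot
      value of at least 1, 2 or 3.\<close>
    let ?A = "if s = k then {} else {p - k}"
    let ?B = "if i + 1 < s \<and> s \<le> i + 1 + m then {p - k - 1} else {}"
    let ?C = "if e = 1 \<and> s = 2 * i + 3 then {p - k - 2} else {}"
    have "covers p \<subseteq> {p - (k - 1)..<p} \<union> ?A \<union> ?B \<union> ?C"
    proof
      fix q
      assume "q \<in> covers p"
      then have q: "0 < q" "q < p" "p \<le> q + pile q"
        by (simp_all add: covers_def)
      have p_eq: "p = ?P + k * i + k + s"
        using less.prems Suc by simp
      show "q \<in> {p - (k - 1)..<p} \<union> ?A \<union> ?B \<union> ?C"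
      proof (cases "p < q + k")
        case True
        then have "q \<in> {p - (k - 1)..<p}"
          using q k by auto
        then show ?thesis
          by blast
      next
        case False
        then have qP: "?P < q"
          using ones[of q] q k by linarith
        define u where "u = q - ?P - 1"
        have q_eq: "q = ?P + u + 1"
          using qP by (simp add: u_def)
        have u: "q = ?P + k * (u div k) + (u mod k + 1)"
          unfolding q_eq using mult_div_mod_eq[of k u] by linarith
        have "u < k * i + k"
          using False p_eq less.prems(3) q_eq by linarith
        then have "u div k \<le> i"
          using less_mult_imp_div_less[of u "Suc i" k] by (simp add: mult.commute)
        moreover have "u mod k + 1 \<le> k"
          using k by (simp add: Suc_le_eq)
        ultimately have "pile q \<le> k - 1 + slot (u div k) (u mod k + 1)"
          using u q by (intro IH) linarith+
        then have "p \<le> q + k + 2"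
          using slot_le[of "u div k" "u mod k + 1"] q k by linarith
        then consider "p = q + k" | "p = q + k + 1" | "p = q + k + 2"
          using False by linarith
        then show ?thesis
        proof cases
          case 1
          then have "pile q \<le> k - 1 + slot i s"
            using p_eq less.prems k by (intro IH) simp_all
          then have "s \<noteq> k"
            using 1 q k by (auto simp: slot_def)
          then show ?thesis
            using 1 by simp
        next
          case 2
          have "s \<noteq> 1"
          proof
            assume "s = 1"
            then have "q = ?P + k * i"
              using p_eq 2 by simp
            moreover from this obtain i' where "i = Suc i'"
              using qP by (cases i) simp_all
            ultimately have "pile q \<le> k - 1 + slot i' k"
              using q k by (intro IH) simp_all
            then show False
              using 2 q k by (simp add: slot_def)
          qed
          then have "pile q \<le> k - 1 + slot i (s - 1)"
            using 2 p_eq less.prems k by (intro IH) auto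
          then have "2 \<le> slot i (s - 1)"
            using 2 q k by linarith
          then have "i + 1 < s \<and> s \<le> i + 1 + m"
            using slot_ge_2[of i "s - 1"] less.prems Suc by linarith
          then show ?thesis
            using 2 by simp
        next
          case 3
          have "s \<noteq> 2"
          proof
            assume "s = 2"
            then have "q = ?P + k * i"
              using p_eq 3 by simp
            moreover from this obtain i' where "i = Suc i'"
              using qP by (cases i) simp_all
            ultimately have "pile q \<le> k - 1 + slot i' k"
              using q k by (intro IH) simp_all
            then show False
              using 3 q k by (simp add: slot_def)
          qed
          \<comment> \<open>The pile would be in slot \<open>k - 1\<close> two windows back, and an
            extra seed there would mean \<open>j + m = k + 1\<close>.\<close>
          moreover have "s \<noteq> 1"
          proof
            assume "s = 1"
            then have qi: "q + 1 = ?P + k * i"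
              using p_eq 3 by simp
            then obtain i' where i': "i = Suc i'"
              using qP by (cases i) simp_all
            then have "pile q \<le> k - 1 + slot i' (k - 1)"
              using q k qi by (intro IH) simp_all
            then have "3 \<le> slot i' (k - 1)"
              using 3 q k by linarith
            then have "e = 1" "k - 1 = 2 * i' + 1"
              using slot_ge_3 by blast+
            then show False
              using e less.prems Suc i' by simp
          qed
          ultimately have "pile q \<le> k - 1 + slot i (s - 2)"
            using 3 p_eq less.prems k by (intro IH) auto
          then have "3 \<le> slot i (s - 2)"
            using 3 q k by linarith
          then have "e = 1 \<and> s = 2 * i + 3"
            using slot_ge_3[of i "s - 2"] \<open>s \<noteq> 1\<close> \<open>s \<noteq> 2\<close> less.prems by linarith
          then show ?thesis
            using 3 by simp
        qed
      qed
    qed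
    then have "card (covers p) \<le> card ({p - (k - 1)..<p} \<union> ?A \<union> ?B \<union> ?C)"
      by (intro card_mono) simp_all
    also have "\<dots> \<le> card {p - (k - 1)..<p} + card ?A + card ?B + card ?C"
      using card_Un_le[of "{p - (k - 1)..<p} \<union> ?A \<union> ?B" ?C]
        card_Un_le[of "{p - (k - 1)..<p} \<union> ?A" ?B] card_Un_le[of "{p - (k - 1)..<p}" ?A] by linarith
    also have "\<dots> \<le> k - 1 + slot j s"
    proof (cases "s = k")
      case True
      \<comment> \<open>The extra seed visits odd slots while \<open>e = 1\<close> makes
        \<open>k\<close> even, so the hole in the last slot survives.\<close>
      have "\<not> (e = 1 \<and> s = 2 * i + 3)"
      proof
        assume "e = 1 \<and> s = 2 * i + 3"
        then have "2 * m = 2 * i + 3"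
          using e True by simp
        then show False
          by presburger
      qed
      then show ?thesis
        using True less.prems Suc k by (simp add: slot_def)
    next
      case False
      have "card {p - (k - 1)..<p} = k - 1"
        using less.prems Suc by simp
      then show ?thesis
        using False e Suc by (simp add: slot_def)
    qed
    finally show ?thesis
      using pile_eq[OF p] c by simp
  qed
qed

lemma depth_hole_config: "triangular (k - 1) + k * (k - m) \<le> depth (hole_config k m e)"
proof -
  \<comment> \<open>The last slot of window \<open>k - 1 - m\<close>, the final window within reach
    of \<open>pile_window\<close>.\<close>
  let ?p = "triangular (k - 1) + k * (k - m)"
  have "k * (k - m) = k * (k - 1 - m) + k"
    using m mult_Suc_right[of k "k - 1 - m"] by (simp add: Suc_diff_Suc)
  then have "pile ?p \<le> k - 1 + slot (k - 1 - m) k"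
    using k m by (intro pile_window) simp_all
  then have "(sow ^^ (?p - 1)) (hole_config k m e) 1 < k"
    using k by (simp add: pile_def slot_def)
  then have "\<not> marching_group k \<le> (sow ^^ (?p - 1)) (hole_config k m e)"
    using k by (auto simp: le_fun_def marching_group_def not_le intro!: exI[of _ 1])
  moreover have "mass (hole_config k m e) = triangular k + (m + e - 1)" "m + e - 1 \<le> k"
    using mass_hole_config triangular_pred[of k] k m e by auto
  ultimately have "?p - 1 < depth (hole_config k m e)"
    using k by (intro less_depth[of k "m + e - 1"]) simp_all
  then show ?thesis
    by linarith
qed

end

section \<open>Configurations that delay the last pile larger than k + 1\<close>

definition tall_config :: "nat \<Rightarrow> nat \<Rightarrow> nat \<Rightarrow> nat" where
  "tall_config k r i =
    (if i = 0 \<or> triangular k + r \<le> i then 0 else if i = triangular k + 1 then 2 else 1)"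

locale tall_family =
  fixes k r :: nat
  assumes k: "2 \<le> k" and r: "2 \<le> r" "r \<le> k"

sublocale tall_family \<subseteq> sowing "tall_config k r"
proof
  show "mancala (tall_config k r)"
    unfolding mancala_def using r
    by (intro exI[of _ "triangular k + r - 1"]) (auto simp: tall_config_def)
qed

context tall_family
begin

lemma mass_tall_config: "mass (tall_config k r) = triangular k + r"
proof -
  let ?d = "triangular k + r"
  have "mass (tall_config k r) = (\<Sum>s=1..<?d. tall_config k r s)"
    using mass_eq_sum_config[of 0 ?d] r by (simp add: tall_config_def)
  also have "\<dots> = (\<Sum>s=1..<?d. 1 + (if s = triangular k + 1 then 1 else 0))"
    by (intro sum.cong) (auto simp: tall_config_def)
  also have "\<dots> = (?d - 1) + 1"
    using r by (subst sum.distrib) (simp add: sum.delta)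
  finally show ?thesis
    using r by simp
qed

lemma pile_ge_k: "triangular (k - 1) < p \<Longrightarrow> k \<le> pile p"
proof (induction p rule: less_induct)
  case (less p)
  show ?case
  proof (cases "p < triangular k + r")
    case True
    then have "0 < tall_config k r p"
      using less.prems by (simp add: tall_config_def)
    then show ?thesis
      using ones_bound[of p k] less.prems by linarith
  next
    case False
    then have p: "triangular (k - 1) + k < p"
      using triangular_pred[of k] k r by simp
    have "{p - k..<p} \<subseteq> covers p"
    proof
      fix q
      assume q: "q \<in> {p - k..<p}"
      then have "k \<le> pile q"
        using p by (intro less.IH) auto
      then show "q \<in> covers p"
        using q p by (auto simp: covers_def)
    qed
    then have "card {p - k..<p} \<le> pile p"
      by (rule card_covers_le[rotated]) (use p in simp)
    then show ?thesis
      using p by simp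
  qed
qed

lemma preceding_cover: "triangular (k - 1) + k < p \<Longrightarrow> {p - k..<p} \<subseteq> covers p"
proof
  fix q
  assume p: "triangular (k - 1) + k < p" and q: "q \<in> {p - k..<p}"
  then have "k \<le> pile q"
    by (intro pile_ge_k) auto
  then show "q \<in> covers p"
    using q p by (auto simp: covers_def)
qed

lemma pile_ge_Suc_k:
  assumes "triangular (k - 1) + k < p" "S \<subseteq> covers p" "\<And>q. q \<in> S \<Longrightarrow> q + k < p" "finite S"
  shows "k + card S \<le> pile p"
proof -
  have "card ({p - k..<p} \<union> S) \<le> pile p"
    using preceding_cover[OF assms(1)] assms by (intro card_covers_le) auto
  moreover have "card ({p - k..<p} \<union> S) = card {p - k..<p} + card S"
    using assms(3,4) by (intro card_Un_disjoint) force+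
  ultimately show ?thesis
    using assms(1) by simp
qed

text \<open>A pile of size at least \<open>k + 2\<close> recurs with period \<open>k + 2\<close>:
  the new one is covered by its \<open>k\<close> predecessors, by the old one and by the pile right
  after the old one. The block of piles above \<open>k\<close> that follows loses one member per
  round, which permits \<open>r - 2\<close> repetitions.\<close>

lemma pile_sweep:
  "j + 2 \<le> r \<Longrightarrow> k + 2 \<le> pile (triangular k + 1 + (k + 2) * j) \<and>
    (\<forall>i. 0 < i \<and> i + j + 2 \<le> r \<longrightarrow> k + 1 \<le> pile (triangular k + 1 + (k + 2) * j + i))"
proof (induction j)
  case 0
  have Tk: "triangular k = triangular (k - 1) + k"
    using k by (intro triangular_pred) simp
  have "tall_config k r (triangular k + 1) + card {triangular k + 1 - k..<triangular k + 1}
      \<le> pile (triangular k + 1)"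
    by (intro pile_ge preceding_cover) (simp_all add: Tk)
  then have "k + 2 \<le> pile (triangular k + 1)"
    using r by (simp add: tall_config_def Tk)
  moreover have "k + 1 \<le> pile (triangular k + 1 + i)" if "0 < i" "i + 2 \<le> r" for i
  proof -
    have "0 < tall_config k r (triangular k + 1 + i)"
      using that by (simp add: tall_config_def)
    then show ?thesis
      using ones_bound[of "triangular k + 1 + i" "k + 1"] by (auto simp: not_less[symmetric])
  qed
  ultimately show ?case
    by simp
next
  case (Suc j)
  let ?q = "triangular k + 1 + (k + 2) * j"
  let ?p = "triangular k + 1 + (k + 2) * Suc j"
  have Tk: "triangular k = triangular (k - 1) + k"
    using k by (intro triangular_pred) simp
  have pq: "?p = ?q + k + 2"
    by simp
  have q: "k + 2 \<le> pile ?q" "\<And>i. 0 < i \<Longrightarrow> i + j + 2 \<le> r \<Longrightarrow> k + 1 \<le> pile (?q + i)"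
    using Suc by simp_all
  have "k + card {?q, ?q + 1} \<le> pile ?p"
    using q(1) q(2)[of 1] Suc.prems unfolding pq
    by (intro pile_ge_Suc_k) (auto simp: covers_def Tk)
  moreover have "k + 1 \<le> pile (?p + i)" if "0 < i" "i + Suc j + 2 \<le> r" for i
  proof -
    have "k + card {?q + (i + 1)} \<le> pile (?p + i)"
      using q(2)[of "i + 1"] that unfolding pq
      by (intro pile_ge_Suc_k) (auto simp: covers_def Tk)
    then show ?thesis
      by simp
  qed
  ultimately show ?case
    by simp
qed

lemma depth_tall_config:
  "triangular (k - 1) + (k + 2) * (r - 1) \<le> depth (tall_config k r)"
proof -
  define q where "q = triangular k + 1 + (k + 2) * (r - 2)"
  have "k + 2 \<le> pile q"
    using pile_sweep[of "r - 2"] r by (simp add: q_def)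
  then have "q \<in> {y. 0 < y \<and> y \<le> q \<and> q + (k + 2) \<le> y + pile y}" (is "_ \<in> ?S")
    by (simp add: q_def)
  moreover have "finite ?S"
    by (rule finite_subset[of _ "{..q}"]) auto
  ultimately have "0 < card ?S"
    using card_gt_0_iff by blast
  then have "0 < (sow ^^ q) (tall_config k r) (k + 2)"
    using config_eq[of "k + 2" q] by simp
  then have "\<not> (sow ^^ q) (tall_config k r) \<le> marching_group (k + 1)"
    by (auto simp: le_fun_def marching_group_def intro!: exI[of _ "k + 2"])
  then have "q < depth (tall_config k r)"
    using k r mass_tall_config by (intro less_depth[of k r]) simp_all
  moreover have "r - 1 = Suc (r - 2)"
    using r by simp
  then have "triangular (k - 1) + (k + 2) * (r - 1) = q + 1"
    using triangular_pred[of k] k by (simp add: q_def)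
  ultimately show ?thesis
    by simp
qed

end

section \<open>The maximal depth in the three cases\<close>

lemma max_depth_eq:
  assumes k: "2 \<le> k" "r \<le> k" and r': "2 * r' < k" "r' \<le> r"
    and D: "triangular (k - 1) + k * (k - 1 - r') \<le> D" "triangular (k - 1) + (k + 2) * (r - 1) \<le> D"
    and c: "mancala c" "mass c = triangular k + r" "D \<le> depth c"
  shows "max_depth (triangular k + r) = D"
proof (rule max_depth_eqI[OF _ c])
  fix c
  assume c: "mancala c" "mass c = triangular k + r"
  then interpret sowing c
    by unfold_locales
  show "depth c \<le> D"
    unfolding depth_def
    by (rule Least_le) (rule augmented_eventually[OF c(2) k r' D])
qed

theorem mainTheorem1:
  fixes n k r :: nat
  assumes "k \<ge> 2" and "r \<le> k" and "n = triangular k + r"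
  shows "int (max_depth n) =
    (if 2 * r < k then 3 * int (triangular (k - 1)) - int k * int r
     else if 2 * r = k then 3 * int (triangular (k - 1)) - int k * (int r - 1)
     else int (triangular (k - 1)) + (int k + 2) * (int r - 1))"
proof -
  note kr = assms(1,2)
  let ?P = "triangular (k - 1)"
  have Tk: "triangular k = ?P + k"
    using kr by (intro triangular_pred) simp
  \<comment> \<open>Replacing \<open>k * (k - 1)\<close> by \<open>2 * ?P\<close> produces the
    factor 3 of the first two cases.\<close>
  have "2 * ?P = k * (k - 1)"
    using kr by (simp add: triangular_def mult.commute)
  then have "int (2 * ?P) = int (k * (k - 1))"
    by (rule arg_cong)
  then have P: "2 * int ?P = int k * (int k - 1)"
    using kr by (simp add: of_nat_diff)
  have surplus: "(k + 2) * (r - 1) \<le> k * r" if "2 * r \<le> k"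
  proof (cases r)
    case (Suc s)
    then show ?thesis
      using that by simp
  qed simp
  consider (less) "2 * r < k" | (eq) "2 * r = k" | (greater) "k < 2 * r"
    by linarith
  then show ?thesis
  proof cases
    case less
    interpret hole_family k "r + 1" 0
      using kr less by unfold_locales simp_all
    have "k * r \<le> k * (k - 1 - r)"
      using less by (intro mult_le_mono2) simp
    with surplus less have "?P + (k + 2) * (r - 1) \<le> ?P + k * (k - 1 - r)"
      by linarith
    moreover have "mass (hole_config k (r + 1) 0) = triangular k + r"
      using mass_hole_config Tk kr by simp
    moreover have "?P + k * (k - 1 - r) \<le> depth (hole_config k (r + 1) 0)"
      using depth_hole_config by simp
    ultimately have "max_depth n = ?P + k * (k - 1 - r)"
      unfolding assms(3) by (intro max_depth_eq[OF kr less le_refl le_refl _ mancala])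
    moreover have "int (k - 1 - r) = int k - 1 - int r"
      using less by simp
    ultimately have "int (max_depth n) = int ?P + int k * (int k - 1 - int r)"
      by (simp only: of_nat_add of_nat_mult)
    then show ?thesis
      using less P by (simp add: algebra_simps)
  next
    case eq
    interpret hole_family k r 1
      using kr eq by unfold_locales simp_all
    have "k * r \<le> k * (k - r)"
      using eq by (intro mult_le_mono2) simp
    with surplus eq have "?P + (k + 2) * (r - 1) \<le> ?P + k * (k - r)"
      by linarith
    moreover have "mass (hole_config k r 1) = triangular k + r"
      using mass_hole_config Tk kr by simp
    \<comment> \<open>Since \<open>2 * r = k\<close>, the largest admissible \<open>r'\<close> is
      \<open>r - 1\<close>.\<close>
    moreover have "2 * (r - 1) < k" "r - 1 \<le> r" "?P + k * (k - 1 - (r - 1)) \<le> ?P + k * (k - r)"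
      using eq kr by simp_all
    ultimately have "max_depth n = ?P + k * (k - r)"
      unfolding assms(3) using depth_hole_config by (intro max_depth_eq[OF kr _ _ _ _ mancala])
    moreover have "int (k - r) = int k - int r"
      using eq by simp
    ultimately have "int (max_depth n) = int ?P + int k * (int k - int r)"
      by (simp only: of_nat_add of_nat_mult)
    then show ?thesis
      using eq P by (simp add: algebra_simps)
  next
    case greater
    interpret tall_family k r
      using kr greater by unfold_locales simp_all
    \<comment> \<open>The largest value with \<open>2 * r' < k\<close>; it brings the bound for
      small piles below the one for large piles.\<close>
    define r' where "r' = (k - 1) div 2"
    have r': "2 * r' < k" "r' \<le> r" "k - 1 - r' \<le> r - 1"
      using greater kr unfolding r'_def by linarith+
    then have "?P + k * (k - 1 - r') \<le> ?P + (k + 2) * (r - 1)"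
      by (intro add_left_mono mult_le_mono) simp_all
    then have "max_depth n = ?P + (k + 2) * (r - 1)"
      unfolding assms(3) using mass_tall_config depth_tall_config
      by (intro max_depth_eq[OF kr r'(1,2) _ le_refl mancala])
    moreover have "int (r - 1) = int r - 1"
      using greater by simp
    ultimately have "int (max_depth n) = int ?P + int (k + 2) * (int r - 1)"
      by (simp only: of_nat_add of_nat_mult)
    then show ?thesis
      using greater by simp
  qed
qed

end
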